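(* Let $\varphi \in \mathcal{S}(\mathbb{D}^2)$ be a Schur function on the bidisc. Suppose there exist Hilbert spaces $\mathcal{H}_1, \mathcal{H}_2$ and an isometric operator (isometric colligation) \[ V=\begin{bmatrix} a&B_1&B_2\\ C_1&D_{1}&D_{2}\\ C_2&0&D_{3} \end{bmatrix} :\mathbb{C} \oplus (\mathcal{H}_1\oplus\mathcal{H}_2) \rightarrow \mathbb{C} \oplus (\mathcal{H}_1\oplus\mathcal{H}_2) \] such that $D_1, D_3 \in C_{0\cdot}$ and $\varphi = \tau_V$. Then $\varphi$ is an inner function.
   Context: $\mathbb{D}^2$ is the open unit bidisc $\{\mathbf{z}=(z_1,z_2)\in\mathbb{C}^2: |z_1|<1, |z_2|<1\}$. $\mathcal{S}(\mathbb{D}^2)$ is the set of Schur functions: bounded analytic functions $\varphi:\mathbb{D}^2\to\mathbb{C}$ with $\sup_{\mathbf{z}\in\mathbb{D}^2}|\varphi(\mathbf{z})|\le 1$. A function $\varphi\in\mathcal{S}(\mathbb{D}^2)$ is inner if $\lim_{r\nearrow 1}|\varphi(re^{it_1},re^{it_2})|=1$ for almost every point $(e^{it_1},e^{it_2})$ of the torus $\mathbb{T}^2$. $C_{0\cdot}$ denotes the set of all contractions $T$ on Hilbert spaces such that $T^n\to 0$ in the strong operator topology as $n\to\infty$. Given a contractive block operator (colligation) $V=\begin{bmatrix} a & B\\ C& D\end{bmatrix}$ on $\mathbb{C}\oplus(\mathcal{H}_1\oplus\mathcal{H}_2)$, with $B=\begin{bmatrix}B_1&B_2\end{bmatrix}$,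 $C=\begin{bmatrix}C_1\\C_2\end{bmatrix}$ and $D$ the compression of $V$ to $\mathcal{H}_1\oplus\mathcal{H}_2$ (here $D=\begin{bmatrix}D_1&D_2\\0&D_3\end{bmatrix}$), its transfer function is \[ \tau_V(\mathbf{z}) = a + B\,(I_{\mathcal{H}_1\oplus\mathcal{H}_2} - E(\mathbf{z})D)^{-1}E(\mathbf{z})\,C \qquad (\mathbf{z}\in\mathbb{D}^2), \] where $E(\mathbf{z})=z_1I_{\mathcal{H}_1}\oplus z_2I_{\mathcal{H}_2}$, and operators from $\mathbb{C}$ to $\mathbb{C}$ are identified with scalars. $V$ is isometric if $V^*V=I$. *)

theory Defs
  imports "HOL-Analysis.Analysis"
begin

section \<open>Complex Hilbert spaces\<close>

text \<open>
  The inner product is linear in the first argument. The real normed-space structure is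
  the one underlying the complex structure.
\<close>

class complex_inner = real_normed_vector +
  fixes scaleC :: "complex \<Rightarrow> 'a \<Rightarrow> 'a" (infixr "*\<^sub>C" 75)
    and cinner :: "'a \<Rightarrow> 'a \<Rightarrow> complex"
  assumes scaleC_add_right: "c *\<^sub>C (x + y) = c *\<^sub>C x + c *\<^sub>C y"
    and scaleC_add_left: "(c + d) *\<^sub>C x = c *\<^sub>C x + d *\<^sub>C x"
    and scaleC_scaleC: "c *\<^sub>C (d *\<^sub>C x) = (c * d) *\<^sub>C x"
    and scaleC_of_real: "complex_of_real r *\<^sub>C x = r *\<^sub>R x"
    and cinner_commute: "cinner x y = cnj (cinner y x)"
    and cinner_add_left: "cinner (x + y) z = cinner x z + cinner y z"
    and cinner_scaleC_left: "cinner (c *\<^sub>C x) y = c * cinner x y"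
    and cinner_ge_zero: "0 \<le> Re (cinner x x)"
    and cinner_eq_zero_iff: "cinner x x = 0 \<longleftrightarrow> x = 0"
    and norm_eq_sqrt_cinner: "norm x = sqrt (Re (cinner x x))"

lemma Im_cinner_self: "Im (cinner x x) = 0"
  using arg_cong[OF cinner_commute[of x x], of Im] by simp

lemma Re_cinner_self: "Re (cinner x x) = (norm x)\<^sup>2"
  by (simp add: norm_eq_sqrt_cinner cinner_ge_zero)

class complex_hilbert = complex_inner + complete_space

instantiation complex :: complex_hilbert
begin

definition "c *\<^sub>C x = c * (x::complex)"
definition "cinner x y = x * cnj (y::complex)"

instance
proof
  fix x :: complex
  show "norm x = sqrt (Re (cinner x x))"
    by (simp add: cinner_complex_def cmod_def power2_eq_square)
qed (auto simp: scaleC_complex_def cinner_complex_def algebra_simps scaleR_conv_of_real)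

end

text \<open>The Hilbert space direct sum; its norm is the library's norm on products.\<close>

instantiation prod :: (complex_inner, complex_inner) complex_inner
begin

definition "c *\<^sub>C x = (c *\<^sub>C fst x, c *\<^sub>C snd x)"
definition "cinner x y = cinner (fst x) (fst y) + cinner (snd x) (snd y)"

instance
proof
  fix x :: "'a \<times> 'b"
  show "cinner x x = 0 \<longleftrightarrow> x = 0"
  proof
    assume "cinner x x = 0"
    then have "Re (cinner (fst x) (fst x)) + Re (cinner (snd x) (snd x)) = 0"
      by (simp add: cinner_prod_def flip: plus_complex.sel)
    then have "Re (cinner (fst x) (fst x)) = 0" "Re (cinner (snd x) (snd x)) = 0"
      using cinner_ge_zero[of "fst x"] cinner_ge_zero[of "snd x"] by linarith+
    then show "x = 0"
      by (simp add: prod_eq_iff complex_eq_iff Im_cinner_self flip: cinner_eq_zero_iff)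
  next
    assume "x = 0"
    then show "cinner x x = 0"
      using cinner_eq_zero_iff[of "0 :: 'a"] cinner_eq_zero_iff[of "0 :: 'b"]
      by (simp add: cinner_prod_def)
  qed
  show "norm x = sqrt (Re (cinner x x))"
    by (simp add: norm_prod_def cinner_prod_def Re_cinner_self)
next
  fix x y :: "'a \<times> 'b"
  show "cinner x y = cnj (cinner y x)"
    using cinner_commute[of "fst x" "fst y"] cinner_commute[of "snd x" "snd y"]
    by (simp add: cinner_prod_def)
qed (auto simp: scaleC_prod_def cinner_prod_def scaleC_add_right scaleC_add_left
      scaleC_scaleC scaleC_of_real cinner_add_left cinner_scaleC_left cinner_ge_zero
      scaleR_prod_def algebra_simps)

end

instance prod :: (complex_hilbert, complex_hilbert) complex_hilbert ..


section \<open>Operators\<close>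

definition bounded_clinear :: "('a::complex_inner \<Rightarrow> 'b::complex_inner) \<Rightarrow> bool" where
  "bounded_clinear T \<longleftrightarrow> bounded_linear T \<and> (\<forall>c x. T (c *\<^sub>C x) = c *\<^sub>C T x)"

definition is_adjoint :: "('a::complex_inner \<Rightarrow> 'b::complex_inner) \<Rightarrow> ('b \<Rightarrow> 'a) \<Rightarrow> bool" where
  "is_adjoint T S \<longleftrightarrow> (\<forall>x y. cinner (T x) y = cinner x (S y))"

text \<open>
  This says \<open>V\<^sup>* V = I\<close>. The adjoint is unique, and it exists for every bounded operator
  between Hilbert spaces, so the existential quantifier only names it.
\<close>

definition isometric :: "('a::complex_inner \<Rightarrow> 'b::complex_inner) \<Rightarrow> bool" where
  "isometric V \<longleftrightarrow> (\<exists>W. is_adjoint V W \<and> W \<circ> V = id)"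

text \<open>The class \<open>C\<^sub>0\<^sub>\<cdot>\<close>.\<close>

definition C0_dot :: "('a::complex_hilbert \<Rightarrow> 'a) \<Rightarrow> bool" where
  "C0_dot T \<longleftrightarrow> bounded_clinear T \<and> onorm T \<le> 1 \<and> (\<forall>x. (\<lambda>n. (T ^^ n) x) \<longlonglongrightarrow> 0)"


section \<open>Schur and inner functions on the bidisc\<close>

definition bidisc :: "(complex \<times> complex) set" where
  "bidisc = {(z1, z2). cmod z1 < 1 \<and> cmod z2 < 1}"

text \<open>
  Analyticity in two variables is complex (Frechet) differentiability at every point,
  in line with \<open>holomorphic_on\<close> in one variable.
\<close>

definition schur_class :: "(complex \<times> complex \<Rightarrow> complex) set" where
  "schur_class = {\<phi>.
     (\<forall>z\<in>bidisc. \<exists>L. bounded_clinear L \<and> (\<phi> has_derivative L) (at z)) \<and>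
     bounded (\<phi> ` bidisc) \<and> (SUP z\<in>bidisc. cmod (\<phi> z)) \<le> 1}"

text \<open>The torus carries arc-length measure, that is, Lebesgue measure in the two angles.\<close>

definition inner_function :: "(complex \<times> complex \<Rightarrow> complex) \<Rightarrow> bool" where
  "inner_function \<phi> \<longleftrightarrow> \<phi> \<in> schur_class \<and>
     (AE t in lebesgue_on ({0..2 * pi} \<times> {0..2 * pi}).
        ((\<lambda>r. cmod (\<phi> (of_real r * cis (fst t), of_real r * cis (snd t)))) \<longlongrightarrow> 1) (at_left 1))"


section \<open>Colligations and transfer functions\<close>

definition colligation ::
  "complex \<Rightarrow> ('h1::complex_hilbert \<Rightarrow> complex) \<Rightarrow> ('h2::complex_hilbert \<Rightarrow> complex) \<Rightarrow>
   (complex \<Rightarrow> 'h1) \<Rightarrow> ('h1 \<Rightarrow> 'h1) \<Rightarrow> ('h2 \<Rightarrow> 'h1) \<Rightarrow>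
   (complex \<Rightarrow> 'h2) \<Rightarrow> ('h1 \<Rightarrow> 'h2) \<Rightarrow> ('h2 \<Rightarrow> 'h2) \<Rightarrow>
   complex \<times> ('h1 \<times> 'h2) \<Rightarrow> complex \<times> ('h1 \<times> 'h2)" where
  "colligation a B1 B2 C1 D11 D12 C2 D21 D22 = (\<lambda>(w, x, y).
     (a * w + B1 x + B2 y,
      C1 w + D11 x + D12 y,
      C2 w + D21 x + D22 y))"

definition E_op :: "complex \<times> complex \<Rightarrow> 'h1::complex_hilbert \<times> 'h2::complex_hilbert \<Rightarrow> 'h1 \<times> 'h2" where
  "E_op z h = (fst z *\<^sub>C fst h, snd z *\<^sub>C snd h)"

text \<open>
  Operators on the scalars are identified with their value at \<open>1\<close>. For contractive \<open>V\<close> and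
  \<open>z\<close> in the bidisc, \<open>I - E(z) D\<close> is bijective, so \<open>inv\<close> is its inverse.
\<close>

definition transfer_function ::
  "(complex \<times> ('h1::complex_hilbert \<times> 'h2::complex_hilbert) \<Rightarrow> complex \<times> ('h1 \<times> 'h2)) \<Rightarrow>
   complex \<times> complex \<Rightarrow> complex" where
  "transfer_function V z =
     (let a = fst (V (1, 0));
          B = (\<lambda>h. fst (V (0, h)));
          C = (\<lambda>w. snd (V (w, 0)));
          D = (\<lambda>h. snd (V (0, h)))
      in a + B (inv (\<lambda>h. h - E_op z (D h)) (E_op z (C 1))))"

end

theory Submission
  imports Defs "HOL-Complex_Analysis.Complex_Analysis"
begin

text \<open>
  Let \<open>(h\<^sub>1, h\<^sub>2) = (I - D E(z))\<^sup>-\<^sup>1 C\<close>. Applying the isometry to \<open>(1, E(z) h)\<close> gives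
  \<open>1 - \<bar>\<phi> z\<bar>\<^sup>2 = (1 - \<bar>z\<^sub>1\<bar>\<^sup>2) \<parallel>h\<^sub>1\<parallel>\<^sup>2 + (1 - \<bar>z\<^sub>2\<bar>\<^sup>2) \<parallel>h\<^sub>2\<parallel>\<^sup>2\<close>. As \<open>D\<close> is triangular, \<open>h\<^sub>2\<close> is the
  power series in \<open>z\<^sub>2\<close> with coefficients \<open>D\<^sub>3\<^sup>n C\<^sub>2\<close>, and \<open>h\<^sub>1\<close> is the one in \<open>z\<^sub>1\<close> with
  coefficients \<open>D\<^sub>1\<^sup>n (C\<^sub>1 + z\<^sub>2 D\<^sub>2 h\<^sub>2)\<close>.
  By Parseval the mean of \<open>1 - \<bar>\<phi>\<bar>\<^sup>2\<close> over the torus of radius \<open>r\<close> is an Abel mean of null sequences,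
  hence tends to \<open>0\<close> as \<open>r \<rightarrow> 1\<close>. It remains to know that \<open>\<phi>\<close> has radial limits almost everywhere
  (Fatou). This follows on each slice \<open>z \<mapsto> \<phi> (z, z w)\<close> from a weak-type bound for the radial
  maximal function, proved here with a \<open>T T\<^sup>*\<close> argument that rests on
  \<open>P\<^bsub>r r'\<^esub> \<le> 8 (P\<^bsub>r\<^esub> + P\<^bsub>r'\<^esub>)\<close> for the Poisson kernel.
\<close>

section \<open>Parseval's identity for Hilbert space valued power series\<close>

subclass (in complex_hilbert) banach ..

section \<open>Algebra of the complex inner product\<close>

lemma cinner_add_right: "cinner x (y + z) = cinner x y + cinner x z"
  by (metis cinner_add_left cinner_commute complex_cnj_add)

lemma cinner_scaleC_right: "cinner x (c *\<^sub>C y) = cnj c * cinner x y"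
  by (metis cinner_scaleC_left cinner_commute complex_cnj_mult)

lemma cinner_zero_left: "cinner 0 x = 0"
  using cinner_add_left[of 0 0 x] by simp

lemma cinner_zero_right: "cinner x 0 = 0"
  using cinner_add_right[of x 0 0] by simp

lemma cinner_sum_left: "cinner (\<Sum>i\<in>A. f i) y = (\<Sum>i\<in>A. cinner (f i) y)"
  by (induction A rule: infinite_finite_induct) (auto simp: cinner_zero_left cinner_add_left)

lemma cinner_sum_right: "cinner y (\<Sum>i\<in>A. f i) = (\<Sum>i\<in>A. cinner y (f i))"
  by (induction A rule: infinite_finite_induct) (auto simp: cinner_zero_right cinner_add_right)

lemma cinner_self: "cinner x x = of_real ((norm x)\<^sup>2)"
  by (simp add: complex_eq_iff Im_cinner_self Re_cinner_self)

text \<open>The class axioms give homogeneity of the norm only for real scalars; for complex ones it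
  comes from sesquilinearity of \<open>cinner\<close>.\<close>

lemma norm_scaleC: "norm (c *\<^sub>C x) = cmod c * norm x"
proof -
  have "complex_of_real ((norm (c *\<^sub>C x))\<^sup>2) = of_real ((cmod c * norm x)\<^sup>2)"
    by (simp only: cinner_self[symmetric] cinner_scaleC_left cinner_scaleC_right)
       (simp add: cinner_self power_mult_distrib complex_norm_square mult_ac del: of_real_power)
  then show ?thesis
    by (metis norm_ge_zero mult_nonneg_nonneg of_real_eq_iff power2_eq_imp_eq)
qed

lemma bounded_linear_scaleC: "bounded_linear (\<lambda>x::'a::complex_inner. c *\<^sub>C x)"
proof (rule bounded_linear_intro)
  show "c *\<^sub>C (x + y) = c *\<^sub>C x + c *\<^sub>C y" for x y :: 'a
    by (rule scaleC_add_right)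
  show "c *\<^sub>C (r *\<^sub>R x) = r *\<^sub>R (c *\<^sub>C x)" for r and x :: 'a
    by (simp add: scaleC_of_real[symmetric] scaleC_scaleC mult.commute)
  show "norm (c *\<^sub>C x) \<le> norm x * cmod c" for x :: 'a
    by (simp add: norm_scaleC mult.commute)
qed

lemmas scaleC_diff_right = bounded_linear.linear[OF bounded_linear_scaleC, THEN linear_diff]

lemma scaleC_one: "1 *\<^sub>C x = x"
  using scaleC_of_real[of 1 x] by simp

lemma continuous_on_scaleC_left:
  fixes x :: "'a::complex_inner"
  assumes "continuous_on S f"
  shows "continuous_on S (\<lambda>t. f t *\<^sub>C x)"
proof -
  have "(r *\<^sub>R c) *\<^sub>C x = r *\<^sub>R (c *\<^sub>C x)" for r c
    by (metis scaleC_of_real scaleC_scaleC scaleR_conv_of_real)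
  then have "bounded_linear (\<lambda>c. c *\<^sub>C x)"
    by (intro bounded_linear_intro[where K = "norm x"]) (simp_all add: scaleC_add_left norm_scaleC)
  from bounded_linear.continuous_on[OF this assms] show ?thesis .
qed

text \<open>Based on \<open>lborel\<close>, so that products and Fubini stay in the Borel setting;
  \<open>AE_torus_lebesgue\<close> returns to Lebesgue measure at the end. The measure is not
  normalised, whence the factors \<open>2 * pi\<close>.\<close>

definition circle :: "real measure" where
  "circle = restrict_space lborel {0..2 * pi}"

lemma borel_measurable_circle:
  assumes "f \<in> borel_measurable borel"
  shows "f \<in> borel_measurable circle"
  unfolding circle_def by (rule measurable_restrict_space1) (use assms in simp)

lemma measurable_circle_borel [measurable]: "(\<lambda>x. x) \<in> circle \<rightarrow>\<^sub>M borel"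
  by (rule borel_measurable_circle) simp

lemma emeasure_circle: "emeasure circle (space circle) = ennreal (2 * pi)"
  by (simp add: circle_def emeasure_restrict_space)

interpretation circle: finite_measure circle
  by standard (simp add: emeasure_circle)

lemma nn_integral_circle:
  "(\<integral>\<^sup>+t. f t \<partial>circle) = (\<integral>\<^sup>+t\<in>{0..2*pi}. f t \<partial>lborel)"
  unfolding circle_def by (rule nn_integral_restrict_space) simp

text \<open>Bridge from gauge integrals, where the Fourier and contour computations take place, to
  nonnegative integrals, where Fubini and limit theorems are applied.\<close>

lemma nn_integral_circle_has_integral:
  assumes "\<And>x. x \<in> {0..2*pi} \<Longrightarrow> 0 \<le> f x" and "(f has_integral I) {0..2*pi}"
  shows "(\<integral>\<^sup>+t. ennreal (f t) \<partial>circle) = ennreal I"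
  unfolding nn_integral_circle using nn_integral_has_integral_lebesgue'[OF assms] by simp

text \<open>Orthogonality of the characters: for \<open>k \<noteq> 0\<close> the antiderivative
  \<open>cis (k * t) / (\<i> * k)\<close> has period \<open>2 * pi\<close>.\<close>

lemma has_integral_cis_int:
  "((\<lambda>t. cis (real_of_int k * t)) has_integral (if k = 0 then complex_of_real (2*pi) else 0)) {0..2*pi}"
proof (cases "k = 0")
  case True
  then show ?thesis
    using has_integral_const_real[of "1::complex" 0 "2*pi"] by (simp add: scaleR_conv_of_real)
next
  case False
  have "((\<lambda>t. cis (real_of_int k * t) / (\<i> * of_int k)) has_vector_derivative cis (real_of_int k * t))
      (at t within {0..2*pi})" for t
  proof -
    have "((\<lambda>z. exp (\<i> * of_int k * z) / (\<i> * of_int k)) has_field_derivative exp (\<i> * of_int k * of_real t)) (at (of_real t))"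
      using False by (auto intro!: derivative_eq_intros)
    from has_vector_derivative_real_field[OF this] show ?thesis
      by (simp add: cis_conv_exp mult_ac has_vector_derivative_at_within)
  qed
  from fundamental_theorem_of_calculus[OF _ this]
  have "((\<lambda>t. cis (real_of_int k * t)) has_integral
      (cis (real_of_int k * (2*pi)) / (\<i> * of_int k) - cis (real_of_int k * 0) / (\<i> * of_int k))) {0..2*pi}"
    by simp
  moreover have "cis (real_of_int k * (2*pi)) = 1"
    using cis_multiple_2pi[of "real_of_int k"] by (simp add: mult_ac)
  ultimately show ?thesis using False by simp
qed

lemma parseval_finite:
  fixes c :: "nat \<Rightarrow> 'a::complex_inner"
  shows "((\<lambda>t. (norm (\<Sum>n<N. cis t ^ n *\<^sub>C c n))\<^sup>2) has_integral 2*pi*(\<Sum>n<N. (norm (c n))\<^sup>2)) {0..2*pi}"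
proof -
  \<comment> \<open>A power and a conjugate power merge into one character. Its frequency is an
    integer because \<open>n - m\<close> may be negative.\<close>
  have phase: "cis t ^ n * (cnj (cis t) ^ m * z) = cis (real_of_int (int n - int m) * t) * z" for t n m z
  proof -
    have "cis t ^ n * cnj (cis t) ^ m = cis (real_of_int (int n - int m) * t)"
      unfolding cis_cnj Complex.DeMoivre cis_mult
      by (rule arg_cong[of _ _ cis]) (simp add: left_diff_distrib)
    then show ?thesis by (simp only: mult.assoc[symmetric])
  qed
  have eq: "(norm (\<Sum>n<N. cis t ^ n *\<^sub>C c n))\<^sup>2 =
     Re (\<Sum>n<N. \<Sum>m<N. cis (real_of_int (int n - int m) * t) * cinner (c n) (c m))" for t
    unfolding Re_cinner_self[symmetric]
    by (subst cinner_sum_left, subst cinner_sum_right, intro arg_cong[of _ _ Re] sum.cong refl)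
      (subst cinner_scaleC_left, subst cinner_scaleC_right, simp only: complex_cnj_power phase)
  have "((\<lambda>t. \<Sum>n<N. \<Sum>m<N. cis (real_of_int (int n - int m) * t) * cinner (c n) (c m)) has_integral
     (\<Sum>n<N. \<Sum>m<N. (if int n - int m = 0 then complex_of_real (2*pi) else 0) * cinner (c n) (c m))) {0..2*pi}"
    by (intro has_integral_sum finite_lessThan has_integral_mult_left has_integral_cis_int)
  also have "(\<Sum>n<N. \<Sum>m<N. (if int n - int m = 0 then complex_of_real (2*pi) else 0) * cinner (c n) (c m)) =
     (\<Sum>n<N. of_real (2*pi*(norm (c n))\<^sup>2))"
    by (intro sum.cong refl) (simp add: if_distrib[of "\<lambda>x. x * _"] cinner_self cong: if_cong)
  finally have "((\<lambda>t. \<Sum>n<N. \<Sum>m<N. cis (real_of_int (int n - int m) * t) * cinner (c n) (c m)) has_integral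
     (\<Sum>n<N. of_real (2*pi*(norm (c n))\<^sup>2))) {0..2*pi}" .
  from has_integral_Re[OF this] show ?thesis
    by (simp add: eq sum_distrib_left)
qed

text \<open>Summable norms are eventually below 1, where squaring decreases them.\<close>

lemma summable_norm_square:
  assumes c: "summable (\<lambda>n. norm (c n))"
  shows "summable (\<lambda>n. (norm (c n))\<^sup>2)"
proof (rule summable_comparison_test_ev[OF _ c])
  have "\<forall>\<^sub>F n in sequentially. norm (c n) < 1"
    by (rule order_tendstoD[OF summable_LIMSEQ_zero[OF c]]) simp
  then show "\<forall>\<^sub>F n in sequentially. norm ((norm (c n))\<^sup>2) \<le> norm (c n)"
    by eventually_elim (simp add: power2_eq_square mult_left_le)
qed

lemma uniform_limit_cis_series:
  fixes c :: "nat \<Rightarrow> 'a::complex_hilbert"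
  assumes c: "summable (\<lambda>n. norm (c n))"
  shows "uniform_limit UNIV (\<lambda>N t. \<Sum>n<N. cis t ^ n *\<^sub>C c n) (\<lambda>t. \<Sum>n. cis t ^ n *\<^sub>C c n) sequentially"
  by (rule Weierstrass_m_test[OF _ c]) (simp add: norm_scaleC norm_power)

lemma continuous_on_cis_series:
  fixes c :: "nat \<Rightarrow> 'a::complex_hilbert"
  assumes c: "summable (\<lambda>n. norm (c n))"
  shows "continuous_on UNIV (\<lambda>t. \<Sum>n. cis t ^ n *\<^sub>C c n)"
  by (rule uniform_limit_theorem[OF _ uniform_limit_cis_series[OF c]])
    (auto intro!: always_eventually continuous_on_sum continuous_on_scaleC_left continuous_intros)

text \<open>Dominated convergence from \<open>parseval_finite\<close>, with the constant majorant
  \<open>(\<Sum>n. norm (c n))\<^sup>2\<close>. In every application the series is restricted to a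
  circle of radius below 1, which makes it absolutely summable.\<close>

lemma parseval:
  fixes c :: "nat \<Rightarrow> 'a::complex_hilbert"
  assumes c: "summable (\<lambda>n. norm (c n))"
  shows "(\<integral>\<^sup>+t. ennreal ((norm (\<Sum>n. cis t ^ n *\<^sub>C c n))\<^sup>2) \<partial>circle) = ennreal (2*pi*(\<Sum>n. (norm (c n))\<^sup>2))"
proof -
  let ?S = "\<lambda>N t. (norm (\<Sum>n<N. cis t ^ n *\<^sub>C c n))\<^sup>2"
  note sq = summable_norm_square[OF c]
  have nrm: "norm (cis t ^ n *\<^sub>C c n) = norm (c n)" for t n
    by (simp add: norm_scaleC norm_power)
  note U = uniform_limit_cis_series[OF c]
  have "(\<lambda>N. \<integral>\<^sup>+t. ennreal (?S N t) \<partial>circle) \<longlonglongrightarrow> (\<integral>\<^sup>+t. ennreal ((norm (\<Sum>n. cis t ^ n *\<^sub>C c n))\<^sup>2) \<partial>circle)"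
  proof (rule nn_integral_dominated_convergence[where w = "\<lambda>_. ennreal ((\<Sum>n. norm (c n))\<^sup>2)"])
    show "AE t in circle. ennreal (?S N t) \<le> ennreal ((\<Sum>n. norm (c n))\<^sup>2)" for N
    proof (intro AE_I2 ennreal_leI power_mono norm_ge_zero)
      fix t
      have "norm (\<Sum>n<N. cis t ^ n *\<^sub>C c n) \<le> (\<Sum>n<N. norm (c n))"
        using norm_sum[of "\<lambda>n. cis t ^ n *\<^sub>C c n" "{..<N}"] by (simp only: nrm)
      also have "\<dots> \<le> (\<Sum>n. norm (c n))"
        by (rule sum_le_suminf[OF c]) auto
      finally show "norm (\<Sum>n<N. cis t ^ n *\<^sub>C c n) \<le> (\<Sum>n. norm (c n))" .
    qed
    show "AE t in circle. (\<lambda>N. ennreal (?S N t)) \<longlonglongrightarrow> ennreal ((norm (\<Sum>n. cis t ^ n *\<^sub>C c n))\<^sup>2)"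
      by (intro AE_I2 tendsto_ennrealI tendsto_power tendsto_norm tendsto_uniform_limitI[OF U]) simp
    show "(\<integral>\<^sup>+ t. ennreal ((\<Sum>n. norm (c n))\<^sup>2) \<partial>circle) < \<infinity>"
      by (simp add: emeasure_circle ennreal_mult_less_top)
  qed (auto intro!: borel_measurable_circle borel_measurable_continuous_onI continuous_on_sum
        continuous_on_scaleC_left continuous_intros continuous_on_cis_series[OF c])
  moreover have "(\<integral>\<^sup>+t. ennreal (?S N t) \<partial>circle) = ennreal (2*pi*(\<Sum>n<N. (norm (c n))\<^sup>2))" for N
    by (rule nn_integral_circle_has_integral) (auto intro: parseval_finite)
  moreover have "(\<lambda>N. ennreal (2*pi*(\<Sum>n<N. (norm (c n))\<^sup>2))) \<longlonglongrightarrow> ennreal (2*pi*(\<Sum>n. (norm (c n))\<^sup>2))"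
    using sq by (intro tendsto_ennrealI tendsto_mult tendsto_const summable_LIMSEQ)
  ultimately show ?thesis
    using LIMSEQ_unique by auto
qed


section \<open>The Poisson kernel\<close>

text \<open>The factor \<open>2 * pi\<close> in the denominator compensates for the mass of
  \<open>circle\<close>, so that the kernel reproduces values without a further constant.\<close>

definition poisson :: "real \<Rightarrow> real \<Rightarrow> real" where
  "poisson r x = (1 - r\<^sup>2) / (2 * pi * (cmod (1 - of_real r * cis x))\<^sup>2)"

lemma one_minus_cis_nonzero:
  assumes "0 \<le> r" "r < 1"
  shows "1 - of_real r * cis x \<noteq> 0"
proof
  assume "1 - of_real r * cis x = 0"
  then have "cmod (of_real r * cis x) = cmod 1" by simp
  then show False using assms by (simp add: norm_mult)
qed

lemma poisson_nonneg: "0 \<le> r \<Longrightarrow> r < 1 \<Longrightarrow> 0 \<le> poisson r x"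
  by (simp add: poisson_def power_le_one)

lemma poisson_minus: "poisson r (- x) = poisson r x"
proof -
  have "1 - of_real r * cis (- x) = cnj (1 - of_real r * cis x)"
    by (simp add: cis_cnj)
  then show ?thesis unfolding poisson_def by (simp only: complex_mod_cnj)
qed

text \<open>A crude bound, uniform in the angle and in radii up to \<open>R\<close>; it supplies the
  constant \<open>B\<close> of \<open>TTstar_maximal\<close>.\<close>

lemma poisson_le:
  assumes "0 \<le> r" "r \<le> R" "R < 1"
  shows "poisson r x \<le> 1 / (2 * pi * (1 - R)\<^sup>2)"
  unfolding poisson_def
proof (rule frac_le)
  have "1 - R \<le> cmod 1 - cmod (of_real r * cis x)"
    using assms by (simp add: norm_mult)
  also have "\<dots> \<le> cmod (1 - of_real r * cis x)"
    by (rule norm_triangle_ineq2)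
  finally show "2 * pi * (1 - R)\<^sup>2 \<le> 2 * pi * (cmod (1 - of_real r * cis x))\<^sup>2"
    using assms by (intro mult_left_mono power_mono) auto
qed (use assms in auto)

lemma continuous_on_poisson:
  assumes "0 \<le> r" "r < 1" "continuous_on S g"
  shows "continuous_on S (\<lambda>s. poisson r (g s))"
  unfolding poisson_def using one_minus_cis_nonzero[OF assms(1,2)] assms(3)
  by (intro continuous_intros) auto

lemma borel_measurable_cis [measurable]: "cis \<in> borel_measurable borel"
  by (intro borel_measurable_continuous_onI continuous_intros)

text \<open>The radius is allowed to vary too, since the maximal function uses a kernel whose radius
  depends on the point.\<close>

lemma borel_measurable_poisson [measurable (raw)]:
  assumes "f \<in> borel_measurable M" "g \<in> borel_measurable M"
  shows "(\<lambda>x. poisson (f x) (g x)) \<in> borel_measurable M"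
proof -
  have [measurable]: "(\<lambda>x. cis (g x)) \<in> borel_measurable M"
    by (rule measurable_compose[OF assms(2) borel_measurable_cis])
  note assms [measurable]
  show ?thesis unfolding poisson_def by measurable
qed

text \<open>Cauchy's formula is applied to \<open>f\<close> times a factor that equals 1 at the
  point \<open>z\<close> and on the unit circle turns the Cauchy kernel into the Poisson
  kernel.\<close>

lemma poisson_formula:
  assumes f: "continuous_on (cball 0 1) f" "f holomorphic_on ball 0 1" and r: "0 \<le> r" "r < 1"
  shows "((\<lambda>s. of_real (poisson r (t - s)) * f (cis s)) has_integral f (of_real r * cis t)) {0..2*pi}"
proof -
  define z where "z = of_real r * cis t"
  have z: "cmod z = r" and "z * cnj z = of_real (r\<^sup>2)"
    using r by (auto simp: z_def norm_mult complex_norm_square[symmetric] simp del: complex_cnj_mult)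
  define g where "g = (\<lambda>w. f w * ((1 - of_real (r\<^sup>2)) / (1 - cnj z * w)))"
  have nz: "1 - cnj z * w \<noteq> 0" if "cmod w \<le> 1" for w
  proof
    assume "1 - cnj z * w = 0"
    then have "cmod (cnj z * w) = cmod 1" by simp
    then have "r * cmod w = 1" by (simp add: norm_mult z)
    moreover have "r * cmod w \<le> r * 1" using r that by (intro mult_left_mono)
    ultimately show False using r by simp
  qed
  have "continuous_on (cball 0 1) g" "g holomorphic_on ball 0 1"
    unfolding g_def using nz by (auto intro!: continuous_intros holomorphic_intros f)
  then have "((\<lambda>u. g u / (u - z)) has_contour_integral (2 * of_real pi * \<i> * g z)) (circlepath 0 1)"
    by (rule Cauchy_integral_circlepath) (use z r in simp)
  moreover have "g z = f z"
    using \<open>z * cnj z = _\<close> nz[of z] z r by (simp add: g_def mult.commute)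
  ultimately have "((\<lambda>s. g (cis s) / (cis s - z) * \<i> * cis s) has_integral (2 * of_real pi * \<i> * f z)) {0..2*pi}"
    by (simp add: circlepath_def has_contour_integral_part_circlepath_iff)
  from has_integral_mult_right[OF this, of "1 / (2 * of_real pi * \<i>)"]
  have "((\<lambda>s. 1 / (2 * of_real pi * \<i>) * (g (cis s) / (cis s - z) * \<i> * cis s)) has_integral f z) {0..2*pi}"
    by simp
  moreover have "1 / (2 * of_real pi * \<i>) * (g (cis s) / (cis s - z) * \<i> * cis s) =
    of_real (poisson r (t - s)) * f (cis s)" for s
  proof -
    \<comment> \<open>Both denominators are expressed through \<open>u\<close>; their product is
      \<open>cis s * (u * cnj u)\<close>, and \<open>u * cnj u\<close> is the denominator of the
      Poisson kernel up to \<open>2 * pi\<close>.\<close>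
    define u where "u = 1 - of_real r * cis (t - s)"
    have u: "u \<noteq> 0" unfolding u_def using r by (rule one_minus_cis_nonzero)
    have 1: "cis s - z = cis s * u"
      by (simp add: u_def z_def right_diff_distrib cis_mult mult.left_commute)
    have 2: "1 - cnj z * cis s = cnj u"
      by (simp add: u_def z_def cis_cnj cis_mult mult.assoc)
    have 3: "complex_of_real (poisson r (t - s)) = (1 - of_real (r\<^sup>2)) / (2 * of_real pi * (u * cnj u))"
      by (simp add: poisson_def u_def[symmetric] complex_norm_square[symmetric])
    show ?thesis unfolding g_def 1 2 3 using u by (simp add: field_simps)
  qed
  ultimately show ?thesis by (simp add: z_def)
qed

text \<open>Subharmonicity of the modulus: the kernel is nonnegative, so taking norms inside the
  Poisson formula leaves it unchanged.\<close>

lemma norm_le_poisson_integral: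
  assumes f: "continuous_on (cball 0 1) f" "f holomorphic_on ball 0 1" and r: "0 \<le> r" "r < 1"
  shows "ennreal (cmod (f (of_real r * cis t))) \<le>
    (\<integral>\<^sup>+s. ennreal (poisson r (t - s)) * ennreal (cmod (f (cis s))) \<partial>circle)"
proof -
  let ?h = "\<lambda>s. poisson r (t - s) * cmod (f (cis s))"
  have "continuous_on {0..2*pi} (\<lambda>s. f (cis s))"
    by (rule continuous_on_compose2[OF f(1)]) (auto intro!: continuous_intros)
  then have "?h integrable_on {0..2*pi}"
    using r by (intro integrable_continuous_interval continuous_intros continuous_on_poisson) auto
  then have I: "(?h has_integral integral {0..2*pi} ?h) {0..2*pi}"
    by (rule integrable_integral)
  have "cmod (f (of_real r * cis t)) \<le> integral {0..2*pi} ?h"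
    unfolding integral_unique[OF poisson_formula[OF assms, of t], symmetric]
    using poisson_formula[OF assms, of t] I
    by (intro integral_norm_bound_integral) (auto simp: norm_mult poisson_nonneg[OF r])
  moreover have "(\<integral>\<^sup>+s. ennreal (?h s) \<partial>circle) = ennreal (integral {0..2*pi} ?h)"
    by (rule nn_integral_circle_has_integral[OF _ I]) (simp add: poisson_nonneg[OF r])
  ultimately show ?thesis
    by (simp add: ennreal_mult'[OF poisson_nonneg[OF r]] ennreal_leI)
qed

text \<open>The second kernel is the real part of a function holomorphic on the disc and continuous
  up to the boundary. The real part of the Poisson formula for that function is the claim.\<close>

lemma poisson_semigroup:
  assumes r: "0 \<le> r" "r < 1" and r': "0 \<le> r'" "r' < 1"
  shows "(\<integral>\<^sup>+s. ennreal (poisson r (t - s)) * ennreal (poisson r' (t' - s)) \<partial>circle) =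
     ennreal (poisson (r * r') (t - t'))"
proof -
  \<comment> \<open>The Herglotz kernel \<open>(1 + u) / (1 - u)\<close>, divided by
    \<open>2 * pi\<close>.\<close>
  define f where "f = (\<lambda>w. (1 + of_real r' * cis (- t') * w) / (1 - of_real r' * cis (- t') * w) / of_real (2 * pi))"
  have nz: "1 - of_real r' * cis (- t') * w \<noteq> 0" if "cmod w \<le> 1" for w
  proof
    assume "1 - of_real r' * cis (- t') * w = 0"
    then have "cmod (of_real r' * cis (- t') * w) = cmod 1" by simp
    then have "r' * cmod w = 1" using r' by (simp add: norm_mult)
    moreover have "r' * cmod w \<le> r' * 1" using r' that by (intro mult_left_mono)
    ultimately show False using r' by simp
  qed
  have cont: "continuous_on (cball 0 1) f" "f holomorphic_on ball 0 1"
    unfolding f_def using nz by (auto intro!: continuous_intros holomorphic_intros)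
  \<comment> \<open>Used twice: \<open>q = 1\<close> identifies the boundary values inside the
    integral, \<open>q = r\<close> the value at the interior point.\<close>
  have Re_f: "Re (f (of_real q * cis s)) = poisson (q * r') (s - t')" if "0 \<le> q" "q \<le> 1" for q s
  proof -
    define u where "u = of_real (q * r') * cis (s - t')"
    have "q * r' < 1" using r' that mult_left_le_one_le[of r' q] by simp
    then have u: "1 - u \<noteq> 0" using one_minus_cis_nonzero[of "q * r'" "s - t'"] r' that by (simp add: u_def)
    have "of_real r' * cis (- t') * (of_real q * cis s) = u"
      by (simp add: u_def cis_mult mult_ac)
    then have "f (of_real q * cis s) = (1 + u) / (1 - u) / of_real (2 * pi)"
      by (simp only: f_def)
    also have "(1 + u) / (1 - u) = (1 + u) * cnj (1 - u) / of_real ((cmod (1 - u))\<^sup>2)"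
      using u by (simp add: complex_norm_square divide_simps del: of_real_power)
    also have "Re (\<dots> / of_real (2 * pi)) = Re ((1 + u) * cnj (1 - u)) / ((cmod (1 - u))\<^sup>2 * (2 * pi))"
      unfolding Re_divide_of_real by (rule divide_divide_eq_left)
    also have "Re ((1 + u) * cnj (1 - u)) = 1 - (cmod u)\<^sup>2"
      unfolding cmod_power2 by (simp add: algebra_simps power2_eq_square)
    also have "cmod u = q * r'"
      using that r' by (simp add: u_def norm_mult)
    finally show ?thesis by (simp add: poisson_def u_def mult.commute)
  qed
  from has_integral_Re[OF poisson_formula[OF cont r, of t]]
  have "((\<lambda>s. poisson r (t - s) * poisson r' (s - t')) has_integral poisson (r * r') (t - t')) {0..2*pi}"
    using Re_f[of 1] Re_f[of r] r by simp
  moreover have "poisson r' (s - t') = poisson r' (t' - s)" for s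
    using poisson_minus[of r' "t' - s"] by simp
  ultimately have "((\<lambda>s. poisson r (t - s) * poisson r' (t' - s)) has_integral poisson (r * r') (t - t')) {0..2*pi}"
    by simp
  from nn_integral_circle_has_integral[OF _ this] show ?thesis
    using r r' by (simp add: poisson_nonneg ennreal_mult)
qed

text \<open>The constant 8 is 4 times 2. With \<open>q = r * r'\<close>, moving from
  \<open>q\<close> to \<open>r\<close> changes \<open>1 - q * cis x\<close> by
  \<open>r - q \<le> 1 - q\<close>, hence at most doubles its modulus and quadruples its square. As
  \<open>r \<le> r'\<close> gives \<open>r\<^sup>2 \<le> q\<close>, the numerator
  \<open>1 - q\<^sup>2\<close> is at most
  \<open>1 - r ^ 4 \<le> 2 * (1 - r\<^sup>2)\<close>.\<close>

lemma poisson_mult_le_left: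
  assumes r: "0 \<le> r" "r \<le> r'" "r' < 1"
  shows "poisson (r * r') x \<le> 8 * poisson r x"
proof -
  define q where "q = r * r'"
  have q: "0 \<le> q" "q \<le> r" "q < 1" "r\<^sup>2 \<le> q"
    using r mult_left_le[of r' r] mult_left_mono[of r r' r] by (auto simp: q_def power2_eq_square)
  let ?u = "cmod (1 - of_real r * cis x)" and ?v = "cmod (1 - of_real q * cis x)"
  have "r * (1 - r') \<le> 1 * (1 - r')" using r by (intro mult_right_mono) auto
  then have "r - q \<le> 1 - q" using r by (simp add: q_def algebra_simps)
  also have "1 - q = cmod 1 - cmod (of_real q * cis x)" using q by (simp add: norm_mult)
  also have "\<dots> \<le> ?v" by (rule norm_triangle_ineq2)
  finally have "r - q \<le> ?v" .
  moreover have "?u \<le> ?v + cmod (of_real (r - q) * cis x)"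
    using norm_triangle_ineq4[of "1 - of_real q * cis x" "of_real (r - q) * cis x"]
    by (simp add: algebra_simps)
  moreover have "cmod (of_real (r - q) * cis x) = r - q"
    using q by (simp only: norm_mult norm_of_real norm_cis) simp
  ultimately have "?u \<le> 2 * ?v" by simp
  then have "?u\<^sup>2 \<le> (2 * ?v)\<^sup>2" by (intro power_mono) auto
  then have uv: "?u\<^sup>2 \<le> 4 * ?v\<^sup>2" by (simp add: power_mult_distrib)
  have pos: "0 < ?u\<^sup>2" "0 < ?v\<^sup>2"
    using one_minus_cis_nonzero[of r x] one_minus_cis_nonzero[of q x] r q by auto
  have "(r\<^sup>2)\<^sup>2 \<le> q\<^sup>2" using q by (intro power_mono) auto
  moreover have "0 \<le> (1 - r\<^sup>2)\<^sup>2" by simp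
  ultimately have "1 - q\<^sup>2 \<le> 2 * (1 - r\<^sup>2)"
    by (simp add: power2_diff)
  moreover have "0 \<le> 1 - r\<^sup>2" using r by (simp add: power_le_one)
  ultimately have "(1 - q\<^sup>2) * ?u\<^sup>2 \<le> (2 * (1 - r\<^sup>2)) * (4 * ?v\<^sup>2)"
    using uv by (intro mult_mono) auto
  moreover have "(2 * b) * (4 * c) = (8 * b) * c" for b c :: real by simp
  ultimately have "(1 - q\<^sup>2) * ?u\<^sup>2 \<le> (8 * (1 - r\<^sup>2)) * ?v\<^sup>2" by (simp only:)
  then have "(1 - q\<^sup>2) / ?v\<^sup>2 \<le> 8 * (1 - r\<^sup>2) / ?u\<^sup>2"
    using pos by (simp only: divide_le_eq le_divide_eq times_divide_eq_left if_True)
  then have "(1 - q\<^sup>2) / ?v\<^sup>2 \<le> 8 * ((1 - r\<^sup>2) / ?u\<^sup>2)" by simp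
  then have "(1 - q\<^sup>2) / ?v\<^sup>2 / (2 * pi) \<le> 8 * ((1 - r\<^sup>2) / ?u\<^sup>2) / (2 * pi)"
    by (rule divide_right_mono) simp
  then show ?thesis by (simp add: poisson_def q_def mult_ac)
qed

text \<open>The kernel of the smaller radius dominates. The sum covers both orders of the radii at
  once and matches the form of \<open>TT\<close> in \<open>TTstar_maximal\<close>.\<close>

lemma poisson_mult_le:
  assumes r: "0 \<le> r" "r < 1" and r': "0 \<le> r'" "r' < 1"
  shows "poisson (r * r') x \<le> 8 * (poisson r x + poisson r' x)"
proof (cases "r \<le> r'")
  case True
  then show ?thesis
    using poisson_mult_le_left[of r r' x] poisson_nonneg[OF r', of x] assms by (simp add: algebra_simps)
next
  case False
  then show ?thesis
    using poisson_mult_le_left[of r' r x] poisson_nonneg[OF r, of x] assms by (simp add: algebra_simps)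
qed


section \<open>Maximal functions and Fatou's theorem\<close>

text \<open>
  Let \<open>T\<close> be the operator with kernel \<open>k\<close>. The hypothesis bounds the kernel of \<open>T T\<^sup>*\<close> by those
  of \<open>T\<close> and \<open>T\<^sup>*\<close>, so that \<open>Q\<close>, the squared norm of \<open>T\<^sup>* 1\<^sub>E\<close>, is controlled by its own
  square root. That \<open>Q\<close> is finite is all that \<open>B\<close> is used for.
\<close>

lemma TTstar_maximal:
  fixes k :: "'a \<Rightarrow> 'a \<Rightarrow> ennreal" and f :: "'a \<Rightarrow> ennreal"
  assumes "finite_measure M"
    and k [measurable]: "case_prod k \<in> borel_measurable (M \<Otimes>\<^sub>M M)"
    and bound: "\<And>t s. k t s \<le> B" "B < \<infinity>"
    and TT: "\<And>t t'. (\<integral>\<^sup>+s. k t s * k t' s \<partial>M) \<le> C * (k t t' + k t' t)"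
    and [measurable]: "E \<in> sets M" "f \<in> borel_measurable M"
    and l: "\<And>t. t \<in> E \<Longrightarrow> l \<le> (\<integral>\<^sup>+s. k t s * f s \<partial>M)"
  shows "l\<^sup>2 * emeasure M E \<le> (2 * C)\<^sup>2 * (\<integral>\<^sup>+s. (f s)\<^sup>2 \<partial>M)"
proof -
  interpret finite_measure M by fact
  interpret pair_sigma_finite M M ..
  let ?I = "indicator E :: 'a \<Rightarrow> ennreal"
  define K where "K = (\<lambda>s. \<integral>\<^sup>+t. k t s * ?I t \<partial>M)"
  have [measurable]: "K \<in> borel_measurable M"
    unfolding K_def by measurable
  define Q where "Q = (\<integral>\<^sup>+s. (K s)\<^sup>2 \<partial>M)"
  define J where "J = (\<integral>\<^sup>+s. ?I s * K s \<partial>M)"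
  have I2: "(\<integral>\<^sup>+s. (?I s)\<^sup>2 \<partial>M) = emeasure M E"
  proof -
    have "(?I s)\<^sup>2 = ?I s" for s by (simp add: indicator_def)
    then show ?thesis by simp
  qed
  have "K s \<le> (\<integral>\<^sup>+t. B \<partial>M)" for s
    unfolding K_def by (intro nn_integral_mono) (auto simp: indicator_def bound)
  then have "(K s)\<^sup>2 \<le> (B * emeasure M (space M))\<^sup>2" for s
    by (intro power_mono) auto
  then have "Q \<le> (\<integral>\<^sup>+s. (B * emeasure M (space M))\<^sup>2 \<partial>M)"
    unfolding Q_def by (intro nn_integral_mono) auto
  also have "\<dots> < \<infinity>"
    using bound(2) emeasure_real[of "space M"]
    by (auto simp: ennreal_mult_less_top power2_eq_square)
  finally have Qfin: "Q < \<infinity>" .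
  \<comment> \<open>The square of \<open>K s\<close> is written as a double integral, so that the
    integration over \<open>s\<close> can be moved innermost, where \<open>TT\<close>
    applies.\<close>
  have "Q = (\<integral>\<^sup>+s. \<integral>\<^sup>+t. \<integral>\<^sup>+t'. k t s * ?I t * (k t' s * ?I t') \<partial>M \<partial>M \<partial>M)"
    unfolding Q_def
  proof (intro nn_integral_cong)
    fix s assume [measurable]: "s \<in> space M"
    have "(\<integral>\<^sup>+t'. k t s * ?I t * (k t' s * ?I t') \<partial>M) = (k t s * ?I t) * K s" for t
      unfolding K_def by (rule nn_integral_cmult) measurable
    then show "(K s)\<^sup>2 = (\<integral>\<^sup>+t. \<integral>\<^sup>+t'. k t s * ?I t * (k t' s * ?I t') \<partial>M \<partial>M)"
      by (simp add: nn_integral_multc K_def power2_eq_square)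
  qed
  also have "\<dots> = (\<integral>\<^sup>+t. \<integral>\<^sup>+s. \<integral>\<^sup>+t'. k t s * ?I t * (k t' s * ?I t') \<partial>M \<partial>M \<partial>M)"
    by (rule Fubini') measurable
  also have "\<dots> = (\<integral>\<^sup>+t. \<integral>\<^sup>+t'. \<integral>\<^sup>+s. k t s * ?I t * (k t' s * ?I t') \<partial>M \<partial>M \<partial>M)"
    by (intro nn_integral_cong Fubini') measurable
  also have "\<dots> \<le> (\<integral>\<^sup>+t. \<integral>\<^sup>+t'. C * ((k t t' * ?I t) * ?I t' + ?I t * (k t' t * ?I t')) \<partial>M \<partial>M)"
  proof (intro nn_integral_mono)
    fix t t' assume [measurable]: "t \<in> space M" "t' \<in> space M"
    have "(\<integral>\<^sup>+s. k t s * ?I t * (k t' s * ?I t') \<partial>M) = (\<integral>\<^sup>+s. k t s * k t' s \<partial>M) * (?I t * ?I t')"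
      by (subst nn_integral_multc[symmetric], measurable) (simp only: mult_ac)
    also have "\<dots> \<le> C * (k t t' + k t' t) * (?I t * ?I t')"
      by (intro mult_right_mono TT) auto
    finally show "(\<integral>\<^sup>+s. k t s * ?I t * (k t' s * ?I t') \<partial>M) \<le>
        C * ((k t t' * ?I t) * ?I t' + ?I t * (k t' t * ?I t'))"
      by (simp add: algebra_simps)
  qed
  also have "\<dots> = C * ((\<integral>\<^sup>+t. \<integral>\<^sup>+t'. (k t t' * ?I t) * ?I t' \<partial>M \<partial>M) +
      (\<integral>\<^sup>+t. \<integral>\<^sup>+t'. ?I t * (k t' t * ?I t') \<partial>M \<partial>M))"
  proof -
    have "(\<integral>\<^sup>+t'. C * ((k t t' * ?I t) * ?I t' + ?I t * (k t' t * ?I t')) \<partial>M) =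
       C * ((\<integral>\<^sup>+t'. (k t t' * ?I t) * ?I t' \<partial>M) + (\<integral>\<^sup>+t'. ?I t * (k t' t * ?I t') \<partial>M))"
      if [measurable]: "t \<in> space M" for t
      by (subst nn_integral_cmult, measurable, subst nn_integral_add) auto
    then have "(\<integral>\<^sup>+t. \<integral>\<^sup>+t'. C * ((k t t' * ?I t) * ?I t' + ?I t * (k t' t * ?I t')) \<partial>M \<partial>M) =
      (\<integral>\<^sup>+t. C * ((\<integral>\<^sup>+t'. (k t t' * ?I t) * ?I t' \<partial>M) + (\<integral>\<^sup>+t'. ?I t * (k t' t * ?I t') \<partial>M)) \<partial>M)"
      by (intro nn_integral_cong)
    also have "\<dots> = C * (\<integral>\<^sup>+t. (\<integral>\<^sup>+t'. (k t t' * ?I t) * ?I t' \<partial>M) + (\<integral>\<^sup>+t'. ?I t * (k t' t * ?I t') \<partial>M) \<partial>M)"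
      by (rule nn_integral_cmult) measurable
    also have "\<dots> = C * ((\<integral>\<^sup>+t. \<integral>\<^sup>+t'. (k t t' * ?I t) * ?I t' \<partial>M \<partial>M) +
      (\<integral>\<^sup>+t. \<integral>\<^sup>+t'. ?I t * (k t' t * ?I t') \<partial>M \<partial>M))"
      by (rule arg_cong[where f = "\<lambda>x. C * x"], rule nn_integral_add) measurable
    finally show ?thesis .
  qed
  \<comment> \<open>Both terms left by \<open>TT\<close> equal \<open>J\<close>, the pairing of the
    indicator of \<open>E\<close> with \<open>K\<close>: this one directly, the other after
    exchanging the integrals.\<close>
  also have "(\<integral>\<^sup>+t. \<integral>\<^sup>+t'. ?I t * (k t' t * ?I t') \<partial>M \<partial>M) = J"
    unfolding J_def K_def by (intro nn_integral_cong nn_integral_cmult) measurable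
  also have "(\<integral>\<^sup>+t. \<integral>\<^sup>+t'. (k t t' * ?I t) * ?I t' \<partial>M \<partial>M) = (\<integral>\<^sup>+t'. \<integral>\<^sup>+t. (k t t' * ?I t) * ?I t' \<partial>M \<partial>M)"
    by (rule Fubini') measurable
  also have "\<dots> = J"
    unfolding J_def K_def
    by (intro nn_integral_cong, subst nn_integral_multc, measurable, rule mult.commute)
  finally have QJ: "Q \<le> 2 * C * J"
    by (simp add: mult_ac flip: mult_2)
  have "J\<^sup>2 \<le> emeasure M E * Q"
    unfolding J_def Q_def I2[symmetric] by (rule Cauchy_Schwarz_nn_integral) measurable
  have "Q\<^sup>2 \<le> (2 * C * J)\<^sup>2"
    using QJ by (rule power_mono) simp
  also have "\<dots> = (2 * C)\<^sup>2 * J\<^sup>2"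
    by (rule power_mult_distrib)
  also have "\<dots> \<le> (2 * C)\<^sup>2 * (emeasure M E * Q)"
    using \<open>J\<^sup>2 \<le> _\<close> by (rule mult_left_mono) simp
  finally have "Q * Q \<le> Q * ((2 * C)\<^sup>2 * emeasure M E)"
    by (simp only: power2_eq_square[of Q] mult_ac)
  \<comment> \<open>Cancelling \<open>Q\<close> is legitimate in \<open>ennreal\<close> because
    \<open>Q\<close> is finite; the case \<open>Q = 0\<close> is trivial.\<close>
  then have Q: "Q \<le> (2 * C)\<^sup>2 * emeasure M E"
    using Qfin by (cases "Q = 0") (auto simp: ennreal_mult_le_mult_iff)
  \<comment> \<open>Duality: on \<open>E\<close> the integral against the kernel is at least
    \<open>l\<close>, and Fubini moves the kernel from \<open>f\<close> to the indicator of
    \<open>E\<close>, producing \<open>K\<close>.\<close>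
  have "l * emeasure M E = (\<integral>\<^sup>+t. l * ?I t \<partial>M)"
    by (simp add: nn_integral_cmult_indicator)
  also have "\<dots> \<le> (\<integral>\<^sup>+t. (\<integral>\<^sup>+s. k t s * f s \<partial>M) * ?I t \<partial>M)"
    using l by (intro nn_integral_mono) (auto simp: indicator_def)
  also have "\<dots> = (\<integral>\<^sup>+t. \<integral>\<^sup>+s. f s * (k t s * ?I t) \<partial>M \<partial>M)"
    by (intro nn_integral_cong, subst nn_integral_multc[symmetric], measurable) (simp only: mult_ac)
  also have "\<dots> = (\<integral>\<^sup>+s. \<integral>\<^sup>+t. f s * (k t s * ?I t) \<partial>M \<partial>M)"
    by (rule Fubini') measurable
  also have "\<dots> = (\<integral>\<^sup>+s. f s * K s \<partial>M)"
    unfolding K_def by (intro nn_integral_cong nn_integral_cmult) measurable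
  finally have "(l * emeasure M E)\<^sup>2 \<le> (\<integral>\<^sup>+s. f s * K s \<partial>M)\<^sup>2"
    by (rule power_mono) simp
  also have "\<dots> \<le> (\<integral>\<^sup>+s. (f s)\<^sup>2 \<partial>M) * Q"
    unfolding Q_def by (rule Cauchy_Schwarz_nn_integral) measurable
  also have "\<dots> \<le> (\<integral>\<^sup>+s. (f s)\<^sup>2 \<partial>M) * ((2 * C)\<^sup>2 * emeasure M E)"
    using Q by (rule mult_left_mono) simp
  finally have "emeasure M E * (l\<^sup>2 * emeasure M E) \<le> emeasure M E * ((2 * C)\<^sup>2 * (\<integral>\<^sup>+s. (f s)\<^sup>2 \<partial>M))"
    by (simp add: power2_eq_square mult_ac)
  then show ?thesis
    by (cases "emeasure M E = 0") (auto simp: ennreal_mult_le_mult_iff emeasure_eq_measure)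
qed

section \<open>Weak-type bound for the radial maximal function\<close>

lemma radial_holomorphic_continuous:
  assumes "f holomorphic_on ball 0 1" "0 \<le> r" "r < 1" "continuous_on S g"
  shows "continuous_on S (\<lambda>t. f (of_real r * cis (g t)))"
  using assms
  by (intro continuous_on_compose2[OF holomorphic_on_imp_continuous_on[OF assms(1)]] continuous_intros)
    (auto simp: norm_mult)

lemma borel_measurable_radial:
  assumes "f holomorphic_on ball 0 1" "0 \<le> r" "r < 1"
  shows "(\<lambda>t. f (of_real r * cis t)) \<in> borel_measurable borel"
  by (intro borel_measurable_continuous_onI radial_holomorphic_continuous assms continuous_on_id)

text \<open>The maximal function is linearised: a measurable choice of a radius
  \<open>\<rho> t\<close> at each \<open>t\<close> gives a single positive kernel, to which
  \<open>TTstar_maximal\<close> applies with \<open>C = 8\<close>; \<open>256\<close> is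
  \<open>(2 * 8)\<^sup>2\<close>. With finitely many radii the choice stays away from 1.\<close>

lemma radial_maximal_finite:
  fixes q :: "nat \<Rightarrow> real" and n :: nat
  assumes f: "f holomorphic_on ball 0 1" and q: "\<And>i. 0 < q i" "\<And>i. q i < 1" and l: "0 < l"
    and A: "\<And>u. 0 < u \<Longrightarrow> u < 1 \<Longrightarrow> (\<integral>\<^sup>+t. ennreal ((cmod (f (of_real u * cis t)))\<^sup>2) \<partial>circle) \<le> A"
  shows "ennreal (l\<^sup>2) * emeasure circle {t\<in>space circle. \<exists>i\<le>n. l < cmod (f (of_real (q i) * cis t))} \<le> 256 * A"
proof -
  define R where "R = Max (q ` {..n})"
  have qR: "q i \<le> R" if "i \<le> n" for i
    using that by (auto simp: R_def)
  have R: "0 < R" "R < 1"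
    using less_le_trans[OF q(1) qR[of 0]] q by (simp_all add: R_def)
  \<comment> \<open>The circle of radius \<open>u\<close> serves as boundary. Lying strictly between
    \<open>R\<close> and 1, it is inside the domain of \<open>f\<close>, and the rescaled radii
    \<open>q i / u\<close> with \<open>i \<le> n\<close> are at most
    \<open>R / u < 1\<close>.\<close>
  define u where "u = (1 + R) / 2"
  have u: "0 < u" "u < 1" "R < u" using R by (auto simp: u_def)
  have [measurable]: "(\<lambda>t. f (of_real (q i) * cis t)) \<in> borel_measurable circle" for i
    using borel_measurable_radial[OF f, of "q i"] q[of i] by (intro borel_measurable_circle) auto
  have [measurable]: "(\<lambda>t. f (of_real u * cis t)) \<in> borel_measurable circle"
    using borel_measurable_radial[OF f, of u] u by (intro borel_measurable_circle) auto
  \<comment> \<open>\<open>LEAST\<close> makes the choice of radius measurable. Off the exceptional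
    set its index may exceed \<open>n\<close> or be arbitrary; \<open>min n\<close> keeps the radius
    bounded there.\<close>
  define \<rho> where "\<rho> = (\<lambda>t. q (min n (LEAST i. l < cmod (f (of_real (q i) * cis t)))) / u)"
  have [measurable]: "\<rho> \<in> borel_measurable circle"
  proof -
    have "Measurable.pred circle (\<lambda>t. l < cmod (f (of_real (q i) * cis t)))" for i
      by measurable
    then have "(\<lambda>t. LEAST i. l < cmod (f (of_real (q i) * cis t))) \<in> circle \<rightarrow>\<^sub>M count_space UNIV"
      by (rule measurable_Least)
    from measurable_compose[OF this, of "\<lambda>i. q (min n i) / u" borel] show ?thesis
      by (simp add: \<rho>_def)
  qed
  have \<rho>: "0 \<le> \<rho> t" "\<rho> t \<le> R / u" "R / u < 1" "\<rho> t < 1" for t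
  proof -
    show "0 \<le> \<rho> t" using q u by (auto simp: \<rho>_def less_imp_le)
    show "\<rho> t \<le> R / u" unfolding \<rho>_def using u by (intro divide_right_mono qR) auto
    moreover show "R / u < 1" using u by simp
    ultimately show "\<rho> t < 1" by simp
  qed
  let ?E = "{t\<in>space circle. \<exists>i\<le>n. l < cmod (f (of_real (q i) * cis t))}"
  let ?k = "\<lambda>t s. ennreal (poisson (\<rho> t) (t - s))"
  have "(ennreal l)\<^sup>2 * emeasure circle ?E \<le>
    (2 * 8)\<^sup>2 * (\<integral>\<^sup>+s. (ennreal (cmod (f (of_real u * cis s))))\<^sup>2 \<partial>circle)"
  proof (rule TTstar_maximal[where k = ?k])
    show "finite_measure circle" by (rule circle.finite_measure_axioms)
    show "case_prod ?k \<in> borel_measurable (circle \<Otimes>\<^sub>M circle)" by measurable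
    show "?k t s \<le> ennreal (1 / (2 * pi * (1 - R / u)\<^sup>2))" for t s
      by (intro ennreal_leI poisson_le \<rho>)
    show "ennreal (1 / (2 * pi * (1 - R / u)\<^sup>2)) < \<infinity>" by simp
    show "(\<integral>\<^sup>+s. ?k t s * ?k t' s \<partial>circle) \<le> 8 * (?k t t' + ?k t' t)" for t t'
    proof -
      have "poisson (\<rho> t * \<rho> t') (t - t') \<le> 8 * (poisson (\<rho> t) (t - t') + poisson (\<rho> t') (t' - t))"
        using poisson_mult_le[of "\<rho> t" "\<rho> t'" "t - t'"] \<rho> poisson_minus[of "\<rho> t'" "t - t'"] by simp
      then have "ennreal (poisson (\<rho> t * \<rho> t') (t - t')) \<le>
          ennreal (8 * (poisson (\<rho> t) (t - t') + poisson (\<rho> t') (t' - t)))"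
        by (rule ennreal_leI)
      also have "\<dots> = 8 * (?k t t' + ?k t' t)"
        by (subst ennreal_mult', simp, subst ennreal_plus) (simp_all add: poisson_nonneg \<rho>)
      finally show ?thesis by (simp only: poisson_semigroup \<rho>)
    qed
    show "?E \<in> sets circle" by measurable
    show "ennreal l \<le> (\<integral>\<^sup>+s. ?k t s * ennreal (cmod (f (of_real u * cis s))) \<partial>circle)" if t: "t \<in> ?E" for t
    proof -
      obtain i where i: "i \<le> n" "l < cmod (f (of_real (q i) * cis t))" using t by auto
      define j where "j = (LEAST i. l < cmod (f (of_real (q i) * cis t)))"
      have "j \<le> i" "l < cmod (f (of_real (q j) * cis t))"
        unfolding j_def using i by (auto intro: Least_le LeastI)
      then have "\<rho> t = q j / u" "l < cmod (f (of_real (q j) * cis t))"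
        using i by (auto simp: \<rho>_def j_def[symmetric])
      moreover from this(1) have "of_real u * (of_real (\<rho> t) * cis t) = of_real (q j) * cis t"
        using u by simp
      ultimately have "ennreal l \<le> ennreal (cmod (f (of_real u * (of_real (\<rho> t) * cis t))))"
        by (simp add: ennreal_leI)
      also have "\<dots> \<le> (\<integral>\<^sup>+s. ?k t s * ennreal (cmod (f (of_real u * cis s))) \<partial>circle)"
      proof (rule norm_le_poisson_integral[of "\<lambda>w. f (of_real u * w)"])
        have *: "of_real u * w \<in> ball 0 1" if "cmod w \<le> 1" for w :: complex
        proof -
          have "u * cmod w \<le> u * 1" using that u by (intro mult_left_mono) auto
          also have "\<dots> < 1" using u by simp
          finally show ?thesis using u by (simp add: norm_mult)
        qed
        show "continuous_on (cball 0 1) (\<lambda>w. f (of_real u * w))"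
          by (intro continuous_on_compose2[OF holomorphic_on_imp_continuous_on[OF f]] continuous_intros)
            (use * in auto)
        show "(\<lambda>w. f (of_real u * w)) holomorphic_on ball 0 1"
          by (intro holomorphic_on_compose_gen[OF _ f, unfolded o_def] holomorphic_intros)
            (use * in auto)
      qed (use \<rho> in auto)
      finally show ?thesis .
    qed
  qed measurable
  also have "\<dots> \<le> (2 * 8)\<^sup>2 * A"
    using A[OF u(1,2)] by (intro mult_left_mono) (simp_all add: ennreal_power)
  finally show ?thesis using l by (simp add: ennreal_power)
qed

text \<open>Exceeding \<open>l\<close> is an open condition on the radius, so rational radii detect
  it. Enumerating them exhausts the set by an increasing sequence of sets to which
  \<open>radial_maximal_finite\<close> applies with a constant independent of
  \<open>n\<close>.\<close>

lemma radial_maximal: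
  assumes f: "f holomorphic_on ball 0 1" and l: "0 < l"
    and A: "\<And>u. 0 < u \<Longrightarrow> u < 1 \<Longrightarrow> (\<integral>\<^sup>+t. ennreal ((cmod (f (of_real u * cis t)))\<^sup>2) \<partial>circle) \<le> A"
  shows "{t\<in>space circle. \<exists>r\<in>{0<..<1}. l < cmod (f (of_real r * cis t))} \<in> sets circle" (is "?E \<in> _")
    and "ennreal (l\<^sup>2) * emeasure circle {t\<in>space circle. \<exists>r\<in>{0<..<1}. l < cmod (f (of_real r * cis t))} \<le> 256 * A"
proof -
  define Q where "Q = \<rat> \<inter> {0<..<1::real}"
  have "countable Q" "Q \<noteq> {}"
    using Rats_dense_in_real[of 0 1] by (auto simp: Q_def countable_rat)
  define q where "q = from_nat_into Q"
  have range_q: "range q = Q"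
    unfolding q_def by (rule range_from_nat_into) fact+
  then have q: "0 < q i" "q i < 1" for i
    using rangeI[of q i] by (auto simp: Q_def)
  define E where "E = (\<lambda>n. {t\<in>space circle. \<exists>i\<le>n. l < cmod (f (of_real (q i) * cis t))})"
  have [measurable]: "(\<lambda>t. f (of_real (q i) * cis t)) \<in> borel_measurable circle" for i
    using borel_measurable_radial[OF f, of "q i"] q[of i] by (intro borel_measurable_circle) auto
  have E [measurable]: "E n \<in> sets circle" for n
    unfolding E_def by measurable
  have "\<exists>i. l < cmod (f (of_real (q i) * cis t))"
    if r: "r \<in> {0<..<1}" "l < cmod (f (of_real r * cis t))" for r t
  proof -
    have "continuous_on {0<..<1} (\<lambda>r. cmod (f (of_real r * cis t)))"
      by (intro continuous_on_norm continuous_on_compose2[OF holomorphic_on_imp_continuous_on[OF f]] continuous_intros)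
        (auto simp: norm_mult)
    then have "open ((\<lambda>r. cmod (f (of_real r * cis t))) -` {l<..} \<inter> {0<..<1})"
      by (simp add: continuous_on_open_vimage)
    moreover have "r \<in> (\<lambda>r. cmod (f (of_real r * cis t))) -` {l<..} \<inter> {0<..<1}"
      using r by auto
    ultimately obtain e where e: "e > 0" "ball r e \<subseteq> (\<lambda>r. cmod (f (of_real r * cis t))) -` {l<..} \<inter> {0<..<1}"
      unfolding open_contains_ball by blast
    obtain r' where "r' \<in> \<rat>" "r < r'" "r' < r + e"
      using Rats_dense_in_real[of r "r + e"] e by auto
    moreover from this have "r' \<in> ball r e" by (simp add: dist_real_def)
    ultimately have "r' \<in> Q" "l < cmod (f (of_real r' * cis t))"
      using e by (auto simp: Q_def)
    then show ?thesis using range_q by auto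
  qed
  then have EU: "?E = (\<Union>n. E n)"
    using q by (fastforce simp: E_def)
  show "?E \<in> sets circle" unfolding EU by measurable
  have "incseq E" by (auto simp: incseq_def E_def) (meson order_trans)
  then have "(\<lambda>n. emeasure circle (E n)) \<longlonglongrightarrow> emeasure circle ?E"
    unfolding EU by (intro Lim_emeasure_incseq) auto
  then have "(\<lambda>n. ennreal (l\<^sup>2) * emeasure circle (E n)) \<longlonglongrightarrow> ennreal (l\<^sup>2) * emeasure circle ?E"
    by (intro ennreal_tendsto_cmult) simp
  moreover have "ennreal (l\<^sup>2) * emeasure circle (E n) \<le> 256 * A" for n
    unfolding E_def using f q l A by (rule radial_maximal_finite)
  ultimately show "ennreal (l\<^sup>2) * emeasure circle ?E \<le> 256 * A"
    by (intro LIMSEQ_le_const2) auto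
qed

text \<open>Existence of the radial limit in Cauchy form. Countably many tolerances and windows,
  together with non-strict inequalities, make the set of such angles Borel, see
  \<open>sets_radially_cauchy\<close>.\<close>

definition radially_cauchy :: "(real \<Rightarrow> 'a::metric_space) \<Rightarrow> bool" where
  "radially_cauchy g \<longleftrightarrow> (\<forall>k::nat. \<exists>m::nat. \<forall>r\<in>{1 - 1 / Suc m<..<1}. \<forall>r'\<in>{1 - 1 / Suc m<..<1}.
     dist (g r) (g r') \<le> 1 / Suc k)"

text \<open>Parseval for the Taylor remainder: coefficients below \<open>N\<close> are set to 0 and
  the series keeps its index range.\<close>

lemma holomorphic_mean_square:
  assumes f: "f holomorphic_on ball 0 1" and u: "0 \<le> u" "u < 1"
  defines "a \<equiv> \<lambda>n. (deriv ^^ n) f 0 / fact n"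
  shows "(\<integral>\<^sup>+t. ennreal ((cmod (f (of_real u * cis t) - (\<Sum>n<N. a n * (of_real u * cis t) ^ n)))\<^sup>2) \<partial>circle) =
    ennreal (2 * pi * (\<Sum>n. (if n < N then 0 else (cmod (a n))\<^sup>2 * u ^ (2 * n))))" (is ?A)
    and "summable (\<lambda>n. (cmod (a n))\<^sup>2 * u ^ (2 * n))" (is ?B)
proof -
  have sums: "(\<lambda>n. a n * w ^ n) sums f w" if "cmod w < 1" for w
    using holomorphic_power_series[OF f, of w] that by (simp add: a_def)
  \<comment> \<open>Convergence at the intermediate radius \<open>v\<close> gives absolute
    convergence at \<open>u\<close>.\<close>
  define v where "v = (1 + u) / 2"
  have v: "u < v" "v < 1" using u by (auto simp: v_def)
  have S': "summable (\<lambda>n. norm (a n * of_real u ^ n))"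
    by (rule powser_insidea[of a "of_real v"]) (use sums[of "of_real v"] u v in \<open>auto intro: sums_summable\<close>)
  then have S: "summable (\<lambda>n. cmod (a n) * u ^ n)"
    using u by (simp add: norm_mult norm_power)
  define c where "c = (\<lambda>n. if n < N then 0 else a n * of_real u ^ n)"
  have "norm (norm (c n)) \<le> cmod (a n) * u ^ n" for n
    using u by (simp add: c_def norm_mult norm_power)
  then have Sc: "summable (\<lambda>n. norm (c n))"
    by (intro summable_comparison_test'[OF S])
  have "(\<Sum>n. cis t ^ n *\<^sub>C c n) = f (of_real u * cis t) - (\<Sum>n<N. a n * (of_real u * cis t) ^ n)" for t
  proof -
    have "(\<lambda>n. if n < N then a n * (of_real u * cis t) ^ n else 0) sums (\<Sum>n<N. a n * (of_real u * cis t) ^ n)"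
      using sums_If_finite_set[of "{..<N}" "\<lambda>n. a n * (of_real u * cis t) ^ n"] by simp
    from sums_diff[OF sums this, of "of_real u * cis t"]
    have "(\<lambda>n. a n * (of_real u * cis t) ^ n - (if n < N then a n * (of_real u * cis t) ^ n else 0)) sums
      (f (of_real u * cis t) - (\<Sum>n<N. a n * (of_real u * cis t) ^ n))"
      using u by (simp add: norm_mult)
    moreover have "a n * (of_real u * cis t) ^ n - (if n < N then a n * (of_real u * cis t) ^ n else 0) = cis t ^ n *\<^sub>C c n" for n
      by (simp add: c_def scaleC_complex_def power_mult_distrib)
    ultimately show ?thesis by (simp add: sums_iff)
  qed
  moreover have "(norm (c n))\<^sup>2 = (if n < N then 0 else (cmod (a n))\<^sup>2 * u ^ (2 * n))" for n
    using u by (simp add: c_def norm_mult norm_power power_mult_distrib power_mult[symmetric] mult.commute)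
  ultimately show ?A using parseval[OF Sc] by simp
  show ?B
    using summable_norm_square[OF S'] u
    by (simp add: norm_mult norm_power power_mult_distrib power_mult[symmetric] mult.commute)
qed

text \<open>A Taylor polynomial has radial limits everywhere, and the maximal function of the
  remainder \<open>g N\<close> is small in measure because the coefficients are square summable. So
  the radial oscillation is below any tolerance almost everywhere.\<close>

lemma fatou_radial:
  assumes f: "f holomorphic_on ball 0 1" and bound: "\<And>z. cmod z < 1 \<Longrightarrow> cmod (f z) \<le> 1"
  shows "AE t in circle. radially_cauchy (\<lambda>r. f (of_real r * cis t))"
proof -
  define a where "a = (\<lambda>n. (deriv ^^ n) f 0 / fact n)"
  define g where "g = (\<lambda>N w. f w - (\<Sum>n<N. a n * w ^ n))"
  have mean_square: "(\<integral>\<^sup>+t. ennreal ((cmod (g N (of_real u * cis t)))\<^sup>2) \<partial>circle) =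
      ennreal (2 * pi * (\<Sum>n. (if n < N then 0 else (cmod (a n))\<^sup>2 * u ^ (2 * n))))"
    and summable_u: "summable (\<lambda>n. (cmod (a n))\<^sup>2 * u ^ (2 * n))" if "0 \<le> u" "u < 1" for u N
    unfolding g_def a_def using holomorphic_mean_square[OF f that] by auto
  have "(\<Sum>n<N. (cmod (a n))\<^sup>2 * u ^ (2 * n)) \<le> 1" if u: "0 \<le> u" "u < 1" for u N
  proof -
    have "ennreal (2 * pi * (\<Sum>n. (cmod (a n))\<^sup>2 * u ^ (2 * n))) =
        (\<integral>\<^sup>+t. ennreal ((cmod (f (of_real u * cis t)))\<^sup>2) \<partial>circle)"
      using mean_square[OF u, of 0] by (simp add: g_def)
    also have "\<dots> \<le> (\<integral>\<^sup>+t. 1 \<partial>circle)"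
      using bound u by (intro nn_integral_mono) (simp add: norm_mult power_le_one)
    also have "\<dots> = ennreal (2 * pi)" by (simp add: emeasure_circle)
    finally have "(\<Sum>n. (cmod (a n))\<^sup>2 * u ^ (2 * n)) \<le> 1" by simp
    moreover have "(\<Sum>n<N. (cmod (a n))\<^sup>2 * u ^ (2 * n)) \<le> (\<Sum>n. (cmod (a n))\<^sup>2 * u ^ (2 * n))"
      by (rule sum_le_suminf[OF summable_u[OF u]]) (use u in auto)
    ultimately show ?thesis by simp
  qed
  \<comment> \<open>The radius tends to 1 inside a finite partial sum, where this is plain
    continuity; the bound 1 survives and gives square summability.\<close>
  then have "eventually (\<lambda>u. (\<Sum>n<N. (cmod (a n))\<^sup>2 * u ^ (2 * n)) \<le> 1) (at_left 1)" for N
    unfolding eventually_at_left_field by (intro exI[of _ 0]) auto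
  moreover have "((\<lambda>u. \<Sum>n<N. (cmod (a n))\<^sup>2 * u ^ (2 * n)) \<longlongrightarrow> (\<Sum>n<N. (cmod (a n))\<^sup>2 * 1 ^ (2 * n))) (at_left 1)" for N
    by (intro tendsto_intros)
  ultimately have "(\<Sum>n<N. (cmod (a n))\<^sup>2) \<le> 1" for N
    using tendsto_upperbound[of _ _ "at_left (1::real)" 1] by fastforce
  then have summable_a: "summable (\<lambda>n. (cmod (a n))\<^sup>2)"
    by (intro summableI_nonneg_bounded) auto
  define T where "T = (\<lambda>N. (\<Sum>n. (cmod (a n))\<^sup>2) - (\<Sum>n<N. (cmod (a n))\<^sup>2))"
  have T: "(\<lambda>n. if n < N then 0 else (cmod (a n))\<^sup>2) sums T N" for N
  proof -
    have "(\<lambda>n. if n < N then (cmod (a n))\<^sup>2 else 0) sums (\<Sum>n<N. (cmod (a n))\<^sup>2)"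
      using sums_If_finite_set[of "{..<N}" "\<lambda>n. (cmod (a n))\<^sup>2"] by simp
    from sums_diff[OF summable_sums[OF summable_a] this]
    have "(\<lambda>n. (cmod (a n))\<^sup>2 - (if n < N then (cmod (a n))\<^sup>2 else 0)) sums T N"
      by (simp add: T_def)
    also have "(\<lambda>n. (cmod (a n))\<^sup>2 - (if n < N then (cmod (a n))\<^sup>2 else 0)) =
        (\<lambda>n. if n < N then 0 else (cmod (a n))\<^sup>2)" by auto
    finally show ?thesis .
  qed
  have "(\<lambda>N. \<Sum>n<N. (cmod (a n))\<^sup>2) \<longlonglongrightarrow> (\<Sum>n. (cmod (a n))\<^sup>2)"
    by (rule summable_LIMSEQ[OF summable_a])
  from tendsto_diff[OF tendsto_const[of "\<Sum>n. (cmod (a n))\<^sup>2"] this] have T0: "T \<longlonglongrightarrow> 0"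
    by (simp add: T_def[abs_def])
  have g: "g N holomorphic_on ball 0 1" for N
    unfolding g_def by (intro holomorphic_intros f)
  have small: "(\<integral>\<^sup>+t. ennreal ((cmod (g N (of_real u * cis t)))\<^sup>2) \<partial>circle) \<le> ennreal (2 * pi * T N)"
    if u: "0 < u" "u < 1" for u N
  proof -
    have le: "(if n < N then 0 else (cmod (a n))\<^sup>2 * u ^ (2 * n)) \<le> (if n < N then 0 else (cmod (a n))\<^sup>2)" for n
      using u by (simp add: mult_left_le power_le_one)
    have "(\<Sum>n. (if n < N then 0 else (cmod (a n))\<^sup>2 * u ^ (2 * n))) \<le> (\<Sum>n. (if n < N then 0 else (cmod (a n))\<^sup>2))"
    proof (rule suminf_le[OF le])
      show "summable (\<lambda>n. if n < N then 0 else (cmod (a n))\<^sup>2)"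
        using T by (rule sums_summable)
      then show "summable (\<lambda>n. if n < N then 0 else (cmod (a n))\<^sup>2 * u ^ (2 * n))"
        by (rule summable_comparison_test'[where N = 0]) (use le u in auto)
    qed
    then show ?thesis
      using mean_square[of u N] u T[of N] by (simp add: sums_iff ennreal_leI)
  qed
  \<comment> \<open>The exceptional points lie in \<open>?E N\<close> for every \<open>N\<close>.
    The measure of \<open>?E N\<close> is at most a constant depending on \<open>l\<close> times the
    tail \<open>T N\<close>, which tends to 0.\<close>
  have "AE t in circle. \<exists>N. \<forall>r\<in>{0<..<1}. cmod (g N (of_real r * cis t)) \<le> l" if l: "l > 0" for l
  proof -
    let ?E = "\<lambda>N. {t\<in>space circle. \<exists>r\<in>{0<..<1}. l < cmod (g N (of_real r * cis t))}"
    let ?Z = "\<Inter>N. ?E N"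
    note E = radial_maximal[OF g l small]
    have Z: "?Z \<in> sets circle" using E(1) by (intro sets.countable_INT) auto
    have "ennreal (l\<^sup>2) * emeasure circle ?Z \<le> 256 * ennreal (2 * pi * T N)" for N
    proof -
      have "emeasure circle ?Z \<le> emeasure circle (?E N)"
        by (intro emeasure_mono E(1)) auto
      then show ?thesis using E(2)[of N] by (meson mult_left_mono order_trans zero_le)
    qed
    moreover have "(\<lambda>N. 256 * ennreal (2 * pi * T N)) \<longlonglongrightarrow> 256 * ennreal (2 * pi * 0)"
      by (intro ennreal_tendsto_cmult tendsto_ennrealI tendsto_mult tendsto_const T0) simp
    ultimately have "ennreal (l\<^sup>2) * emeasure circle ?Z \<le> 0"
      by (intro LIMSEQ_le_const) auto
    then have "emeasure circle ?Z = 0" using l by simp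
    then show ?thesis
      using Z by (intro AE_I'[of ?Z]) (auto simp: null_sets_def not_le)
  qed
  \<comment> \<open>The tolerance \<open>e = 1 / Suc k\<close> is spent in thirds: one on each of
    the two remainders and one on the polynomial, whose third is two distances of
    \<open>e / 6\<close> to its value at 1.\<close>
  then have "AE t in circle. \<forall>k::nat. \<exists>N. \<forall>r\<in>{0<..<1}. cmod (g N (of_real r * cis t)) \<le> 1 / (3 * Suc k)"
    by (subst AE_all_countable) simp
  then show ?thesis
  proof eventually_elim
    case (elim t)
    show ?case unfolding radially_cauchy_def
    proof
      fix k :: nat
      define e where "e = 1 / real (Suc k)"
      then have "0 < e / 6" by simp
      obtain N where "\<forall>r\<in>{0<..<1}. cmod (g N (of_real r * cis t)) \<le> 1 / (3 * Suc k)"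
        using elim by blast
      then have N: "cmod (g N (of_real r * cis t)) \<le> e / 3" if "r \<in> {0<..<1}" for r
        using that by (simp only: e_def divide_divide_eq_left of_nat_mult of_nat_numeral mult.commute)
      define p where "p = (\<lambda>r::real. \<Sum>n<N. a n * (of_real r * cis t) ^ n)"
      have "p \<midarrow>1\<rightarrow> p 1" unfolding p_def by (intro tendsto_intros)
      from tendstoD[OF this \<open>0 < e / 6\<close>] obtain d where d: "d > 0"
        "\<And>r. r \<noteq> 1 \<Longrightarrow> dist r 1 < d \<Longrightarrow> dist (p r) (p 1) < e / 6"
        by (auto simp: eventually_at)
      obtain m where m: "1 / real (Suc m) < d" using nat_approx_posE[OF d(1)] by blast
      have "dist (f (of_real r * cis t)) (f (of_real r' * cis t)) \<le> e"
        if r: "r \<in> {1 - 1 / Suc m<..<1}" "r' \<in> {1 - 1 / Suc m<..<1}" for r r'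
      proof -
        have "1 / real (Suc m) \<le> 1" by simp
        with r have r01: "r \<in> {0<..<1}" "r' \<in> {0<..<1}"
          unfolding greaterThanLessThan_iff by linarith+
        have "dist r 1 < d" "dist r' 1 < d"
          using r m unfolding greaterThanLessThan_iff dist_real_def by linarith+
        moreover have "r \<noteq> 1" "r' \<noteq> 1" using r by auto
        ultimately have "dist (p r) (p 1) < e / 6" "dist (p r') (p 1) < e / 6"
          using d(2) by blast+
        then have "dist (p r) (p r') < e / 3"
          using dist_triangle2[of "p r" "p r'" "p 1"] by simp
        moreover have "f (of_real q * cis t) = p q + g N (of_real q * cis t)" for q
          by (simp add: p_def g_def)
        moreover note N[OF r01(1)] N[OF r01(2)]
          norm_triangle_ineq[of "p r - p r'" "g N (of_real r * cis t) - g N (of_real r' * cis t)"]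
          norm_triangle_ineq4[of "g N (of_real r * cis t)" "g N (of_real r' * cis t)"]
        ultimately show ?thesis
          by (simp add: dist_norm algebra_simps)
      qed
      then show "\<exists>m. \<forall>r\<in>{1 - 1 / real (Suc m)<..<1}. \<forall>r'\<in>{1 - 1 / real (Suc m)<..<1}.
           dist (f (of_real r * cis t)) (f (of_real r' * cis t)) \<le> 1 / real (Suc k)"
        unfolding e_def by blast
    qed
  qed
qed


section \<open>Radial limits on the bidisc\<close>

lemma schur_class_norm_le_1:
  assumes "\<phi> \<in> schur_class" "z \<in> bidisc"
  shows "cmod (\<phi> z) \<le> 1"
proof -
  have "bdd_above ((\<lambda>z. cmod (\<phi> z)) ` bidisc)"
    using assms(1) by (auto simp: schur_class_def bounded_iff intro: bdd_aboveI2)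
  from cSUP_upper[OF assms(2) this] show ?thesis
    using assms(1) by (auto simp: schur_class_def)
qed

lemma schur_class_continuous_on:
  assumes "\<phi> \<in> schur_class"
  shows "continuous_on bidisc \<phi>"
  using assms unfolding schur_class_def
  by (auto intro!: continuous_at_imp_continuous_on intro: has_derivative_continuous)

text \<open>Along the slice the derivative is \<open>\<lambda>h. L (h * w1, h * w2)\<close>; complex
  linearity of \<open>L\<close> makes it multiplication by the number
  \<open>L (w1, w2)\<close>.\<close>

lemma schur_class_slice_holomorphic:
  assumes "\<phi> \<in> schur_class" "cmod w1 \<le> 1" "cmod w2 \<le> 1"
  shows "(\<lambda>z. \<phi> (z * w1, z * w2)) holomorphic_on ball 0 1"
proof (rule holomorphic_onI)
  fix z :: complex assume "z \<in> ball 0 1"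
  then have z: "cmod z < 1" by simp
  have "cmod z * cmod w < 1" if "cmod w \<le> 1" for w
    using mult_left_mono[OF that, of "cmod z"] z by simp
  then have "(z * w1, z * w2) \<in> bidisc"
    using assms(2,3) by (simp add: bidisc_def norm_mult)
  then obtain L where L: "bounded_clinear L" "(\<phi> has_derivative L) (at (z * w1, z * w2))"
    using assms(1) by (auto simp: schur_class_def)
  have "((\<lambda>z. \<phi> (z * w1, z * w2)) has_derivative (\<lambda>h. L (h * w1, h * w2))) (at z)"
    by (rule has_derivative_compose[where f = "\<lambda>z. (z * w1, z * w2)" and g = \<phi>, OF _ L(2)])
      (auto intro!: derivative_eq_intros)
  moreover have "L (h * w1, h * w2) = L (w1, w2) * h" for h
    using L(1) unfolding bounded_clinear_def
    by (auto simp: scaleC_prod_def scaleC_complex_def mult.commute dest!: spec[of _ h] spec[of _ "(w1, w2)"])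
  ultimately have "((\<lambda>z. \<phi> (z * w1, z * w2)) has_field_derivative L (w1, w2)) (at z)"
    by (simp add: has_field_derivative_def)
  then show "(\<lambda>z. \<phi> (z * w1, z * w2)) field_differentiable at z within ball 0 1"
    by (auto simp: field_differentiable_def intro: has_field_derivative_at_within)
qed

section \<open>Measurability on the torus\<close>

lemma in_bidisc_radial: "0 \<le> r \<Longrightarrow> r < 1 \<Longrightarrow> (of_real r * cis x, of_real r * cis y) \<in> bidisc"
  by (simp add: bidisc_def norm_mult)

lemma continuous_on_torus_radial:
  assumes "continuous_on bidisc \<phi>" "0 \<le> r" "r < 1"
  shows "continuous_on UNIV (\<lambda>t. \<phi> (of_real r * cis (fst t), of_real r * cis (snd t)))"
  by (rule continuous_on_compose2[OF assms(1)])
    (auto intro!: continuous_intros in_bidisc_radial assms)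

text \<open>For fixed radii the inequality is closed in the angles. The intersection over all radii
  in a window is uncountable but still closed, and only countable operations over \<open>k\<close>
  and \<open>m\<close> remain.\<close>

lemma sets_radially_cauchy:
  assumes "continuous_on bidisc (\<phi> :: complex \<times> complex \<Rightarrow> complex)"
  shows "{t. radially_cauchy (\<lambda>r. \<phi> (of_real r * cis (fst t), of_real r * cis (snd t)))} \<in> sets borel"
proof -
  let ?f = "\<lambda>r t. \<phi> (of_real r * cis (fst t), of_real r * cis (snd t))"
  let ?I = "\<lambda>m. {1 - 1 / real (Suc m)<..<1}"
  have "closed {t. dist (?f r t) (?f r' t) \<le> 1 / real (Suc k)}"
    if "r \<in> ?I m" "r' \<in> ?I m" for r r' k m
  proof -
    have "1 / real (Suc m) \<le> 1" by simp
    with that have "0 \<le> r" "r < 1" "0 \<le> r'" "r' < 1"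
      unfolding greaterThanLessThan_iff by linarith+
    then show ?thesis
      by (intro closed_Collect_le continuous_intros continuous_on_torus_radial assms)
  qed
  then have "closed (\<Inter>r\<in>?I m. \<Inter>r'\<in>?I m. {t. dist (?f r t) (?f r' t) \<le> 1 / real (Suc k)})" for k m
    by (intro closed_INT ballI) auto
  then have "(\<Inter>k. \<Union>m. \<Inter>r\<in>?I m. \<Inter>r'\<in>?I m. {t. dist (?f r t) (?f r' t) \<le> 1 / real (Suc k)}) \<in> sets borel"
    by (intro sets.countable_INT'' sets.countable_UN'' borel_closed) auto
  also have "(\<Inter>k. \<Union>m. \<Inter>r\<in>?I m. \<Inter>r'\<in>?I m. {t. dist (?f r t) (?f r' t) \<le> 1 / real (Suc k)}) =
      {t. radially_cauchy (\<lambda>r. ?f r t)}"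
    by (rule set_eqI) (simp only: INT_iff UN_iff mem_Collect_eq radially_cauchy_def ball_UNIV bex_UNIV)
  finally show ?thesis .
qed

section \<open>Almost everywhere statements on the torus\<close>

interpretation torus: pair_sigma_finite circle circle ..

lemma borel_measurable_torus:
  assumes "f \<in> borel_measurable borel"
  shows "f \<in> borel_measurable (circle \<Otimes>\<^sub>M circle)"
proof -
  have "(\<lambda>t. (fst t, snd t)) \<in> circle \<Otimes>\<^sub>M circle \<rightarrow>\<^sub>M borel \<Otimes>\<^sub>M borel"
    by measurable
  then have "(\<lambda>t. t) \<in> circle \<Otimes>\<^sub>M circle \<rightarrow>\<^sub>M borel" by (simp add: borel_prod)
  from measurable_compose[OF this assms] show ?thesis .
qed

text \<open>
  In the coordinates \<open>(x, y - x)\<close> the torus is fibred by the circles on which the slice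
  functions \<open>\<lambda>z. \<phi> (z, z * cis y)\<close> live, so the one-variable theorem applies fibrewise.
\<close>

lemma fatou_radial_torus:
  assumes \<phi>: "\<phi> \<in> schur_class"
  shows "AE t in circle \<Otimes>\<^sub>M circle. radially_cauchy (\<lambda>r. \<phi> (of_real r * cis (fst t), of_real r * cis (snd t)))"
proof -
  interpret pair_sigma_finite circle "lborel :: real measure" ..
  let ?P = "\<lambda>t. radially_cauchy (\<lambda>r. \<phi> (of_real r * cis (fst t), of_real r * cis (snd t)))"
  define f where "f = (\<lambda>t::real \<times> real. if ?P t then 0 else 1 :: ennreal)"
  have f: "f \<in> borel_measurable borel"
    unfolding f_def using sets_radially_cauchy[OF schur_class_continuous_on[OF \<phi>]]
    by (intro measurable_If) auto
  note [measurable] = f[folded borel_prod] borel_measurable_torus[OF f]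
  have slice: "AE x in circle. ?P (x, x + y)" for y
  proof -
    have "(\<lambda>z. \<phi> (z * 1, z * cis y)) holomorphic_on ball 0 1"
      by (rule schur_class_slice_holomorphic[OF \<phi>]) auto
    then have "AE x in circle. radially_cauchy (\<lambda>r. \<phi> (of_real r * cis x * 1, of_real r * cis x * cis y))"
      by (rule fatou_radial) (auto intro!: schur_class_norm_le_1[OF \<phi>] simp: bidisc_def norm_mult)
    then show ?thesis by (simp add: cis_mult mult.assoc)
  qed
  \<comment> \<open>The inner integral is enlarged from one period to the whole line, which the
    shift by \<open>x\<close> maps onto itself; after Fubini each fibre contributes 0 by
    \<open>slice\<close>.\<close>
  have "(\<integral>\<^sup>+x. \<integral>\<^sup>+y. f (x, y) \<partial>circle \<partial>circle) \<le> (\<integral>\<^sup>+x. \<integral>\<^sup>+y. f (x, y) \<partial>lborel \<partial>circle)"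
    by (intro nn_integral_mono, subst nn_integral_circle) (auto intro!: nn_integral_mono simp: indicator_def)
  also have "\<dots> = (\<integral>\<^sup>+x. \<integral>\<^sup>+y. f (x, x + y) \<partial>lborel \<partial>circle)"
    by (rule nn_integral_cong, subst nn_integral_real_affine[where c = 1]) auto
  also have "\<dots> = (\<integral>\<^sup>+y. \<integral>\<^sup>+x. f (x, x + y) \<partial>circle \<partial>lborel)"
    by (rule Fubini'[symmetric]) measurable
  also have "\<dots> = (\<integral>\<^sup>+y. 0 \<partial>(lborel :: real measure))"
  proof (intro nn_integral_cong)
    fix y :: real
    have "(\<integral>\<^sup>+x. f (x, x + y) \<partial>circle) = (\<integral>\<^sup>+x. 0 \<partial>circle)"
      by (rule nn_integral_cong_AE) (use slice[of y] in eventually_elim, simp add: f_def)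
    then show "(\<integral>\<^sup>+x. f (x, x + y) \<partial>circle) = 0" by simp
  qed
  finally have "(\<integral>\<^sup>+t. f t \<partial>(circle \<Otimes>\<^sub>M circle)) = 0"
    by (subst circle.nn_integral_fst[symmetric]) auto
  then have "AE t in circle \<Otimes>\<^sub>M circle. f t = 0"
    by (subst (asm) nn_integral_0_iff_AE) auto
  then show ?thesis by eventually_elim (auto simp: f_def split: if_splits)
qed

text \<open>The exceptional set is Borel, so Tonelli computes its measure in the square, and null
  sets stay null in the completion.\<close>

lemma AE_torus_lebesgue:
  assumes P: "{t. P t} \<in> sets borel" and AE: "AE t in circle \<Otimes>\<^sub>M circle. P t"
  shows "AE t in lebesgue_on ({0..2*pi} \<times> {0..2*pi}). P t"
proof -
  define N where "N = {t. \<not> P t}"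
  have N: "N \<in> sets borel"
    unfolding N_def Collect_neg_eq using P by (rule borel_comp)
  note [measurable] = N[folded borel_prod]
  have [measurable]: "(indicator N :: _ \<Rightarrow> ennreal) \<in> borel_measurable (circle \<Otimes>\<^sub>M circle)"
    by (intro borel_measurable_torus borel_measurable_indicator N)
  let ?T = "{0..2*pi} \<times> {0..2*pi}"
  have "emeasure lborel (?T \<inter> N) = emeasure (lborel \<Otimes>\<^sub>M lborel) (?T \<inter> N)"
    by (simp add: lborel_prod)
  also have "\<dots> = (\<integral>\<^sup>+x. \<integral>\<^sup>+y. indicator (?T \<inter> N) (x, y) \<partial>lborel \<partial>lborel)"
    by (rule lborel.emeasure_pair_measure) simp
  also have "\<dots> = (\<integral>\<^sup>+x. (\<integral>\<^sup>+y. indicator N (x, y) \<partial>circle) \<partial>circle)"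
    unfolding nn_integral_circle
  proof (rule nn_integral_cong)
    fix x :: real
    show "(\<integral>\<^sup>+y. indicator (?T \<inter> N) (x, y) \<partial>lborel) =
      (\<integral>\<^sup>+y\<in>{0..2*pi}. indicator N (x, y) \<partial>lborel) * indicator {0..2*pi} x"
      by (cases "x \<in> {0..2*pi}") (auto intro!: nn_integral_cong simp: indicator_def)
  qed
  also have "\<dots> = (\<integral>\<^sup>+t. indicator N t \<partial>(circle \<Otimes>\<^sub>M circle))"
    by (rule circle.nn_integral_fst) measurable
  also have "\<dots> = (\<integral>\<^sup>+t. 0 \<partial>(circle \<Otimes>\<^sub>M circle))"
    by (rule nn_integral_cong_AE) (use AE in eventually_elim, simp add: N_def)
  finally have "?T \<inter> N \<in> null_sets lborel"
    using N by (intro null_setsI sets.Int) (auto simp: lborel_prod intro!: borel_closed closed_Times)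
  then have "?T \<inter> N \<in> null_sets lebesgue"
    by (rule null_sets_completionI)
  moreover have "?T \<in> sets lborel"
    by (simp add: borel_closed closed_Times)
  then have "?T \<in> sets lebesgue"
    by (rule sets_completionI_sets)
  ultimately show ?thesis
    by (subst AE_restrict_space_iff) (auto intro!: AE_I'[of "?T \<inter> N"] simp: N_def)
qed


section \<open>Triangular isometric colligations\<close>

lemma bounded_clinearD:
  assumes "bounded_clinear T"
  shows "bounded_linear T" "T (c *\<^sub>C x) = c *\<^sub>C T x" "T (x + y) = T x + T y" "T (x - y) = T x - T y" "T 0 = 0"
  using assms by (auto simp: bounded_clinear_def linear_simps)

lemma isometric_norm:
  assumes "isometric V"
  shows "norm (V x) = norm x"
proof -
  obtain W where "is_adjoint V W" "W \<circ> V = id" using assms by (auto simp: isometric_def)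
  then have "cinner (V x) (V x) = cinner x x"
    by (metis comp_apply id_apply is_adjoint_def)
  then show ?thesis by (simp add: norm_eq_sqrt_cinner)
qed

lemma norm_Pair_square: "(norm (x, y))\<^sup>2 = (norm x)\<^sup>2 + (norm y)\<^sup>2"
  by (simp add: norm_prod_def)

text \<open>The Neumann series of the inverse of \<open>I - z T\<close>, taken as definition because
  Parseval is applied to its coefficients.\<close>

definition resolvent :: "('a::complex_hilbert \<Rightarrow> 'a) \<Rightarrow> complex \<Rightarrow> 'a \<Rightarrow> 'a" where
  "resolvent T z x = (\<Sum>n. z ^ n *\<^sub>C (T ^^ n) x)"

section \<open>Resolvents of contractions\<close>

locale contraction =
  fixes T :: "'a::complex_hilbert \<Rightarrow> 'a"
  assumes clinear: "bounded_clinear T"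
    and contr: "norm (T x) \<le> norm x"
begin

lemma funpow_clinear: "bounded_clinear (T ^^ n)"
proof (induction n)
  case 0
  then show ?case by (simp add: bounded_clinear_def bounded_linear_ident id_def)
next
  case (Suc n)
  have "bounded_linear (\<lambda>x. T ((T ^^ n) x))"
    using bounded_linear_compose[OF bounded_clinearD(1)[OF clinear] bounded_clinearD(1)[OF Suc]] .
  then show ?case
    by (simp add: bounded_clinear_def o_def bounded_clinearD(2)[OF Suc] bounded_clinearD(2)[OF clinear])
qed

lemma funpow_contr: "norm ((T ^^ n) x) \<le> norm x"
  by (induction n) (auto intro: order_trans[OF contr])

lemma summable_resolvent:
  assumes "cmod z < 1"
  shows "summable (\<lambda>n. norm (z ^ n *\<^sub>C (T ^^ n) x))"
proof (rule summable_comparison_test')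
  show "summable (\<lambda>n. cmod z ^ n * norm x)"
    using assms by (intro summable_mult2 summable_geometric) auto
  show "norm (norm (z ^ n *\<^sub>C (T ^^ n) x)) \<le> cmod z ^ n * norm x" for n
    by (simp add: norm_scaleC norm_power mult_left_mono funpow_contr)
qed

lemma resolvent_eq:
  assumes "cmod z < 1"
  shows "resolvent T z x = x + T (z *\<^sub>C resolvent T z x)"
proof -
  have s: "summable (\<lambda>n. z ^ n *\<^sub>C (T ^^ n) x)"
    by (rule summable_norm_cancel[OF summable_resolvent[OF assms]])
  have L: "bounded_linear (\<lambda>y. T (z *\<^sub>C y))"
    by (rule bounded_linear_compose[OF bounded_clinearD(1)[OF clinear] bounded_linear_scaleC])
  have "resolvent T z x = x + (\<Sum>n. z ^ Suc n *\<^sub>C (T ^^ Suc n) x)"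
    unfolding resolvent_def using suminf_split_head[OF s] by (simp add: scaleC_one)
  also have "(\<Sum>n. z ^ Suc n *\<^sub>C (T ^^ Suc n) x) = (\<Sum>n. T (z *\<^sub>C (z ^ n *\<^sub>C (T ^^ n) x)))"
    by (simp add: bounded_clinearD(2)[OF clinear] scaleC_scaleC)
  also have "\<dots> = T (z *\<^sub>C resolvent T z x)"
    unfolding resolvent_def by (rule bounded_linear.suminf[OF L s, symmetric])
  finally show ?thesis .
qed

text \<open>Uniqueness counterpart of \<open>resolvent_eq\<close>: \<open>z T\<close> strictly
  decreases the norm of nonzero vectors.\<close>

lemma fixed_point_zero:
  assumes "cmod z < 1" "x = z *\<^sub>C T x"
  shows "x = 0"
proof (rule ccontr)
  assume "x \<noteq> 0"
  have "norm x = cmod z * norm (T x)" using assms(2) by (metis norm_scaleC)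
  also have "\<dots> \<le> cmod z * norm x" by (intro mult_left_mono contr) auto
  also have "\<dots> < norm x" using assms(1) \<open>x \<noteq> 0\<close> by simp
  finally show False by simp
qed

text \<open>Parseval turns the mean square into a power series in \<open>r\<^sup>2\<close>;
  multiplied by \<open>1 - r\<^sup>2\<close> it is an Abel mean of the squared orbit norms.\<close>

lemma mean_square_resolvent:
  assumes r: "0 \<le> r" "r < 1"
  shows "(\<integral>\<^sup>+t. ennreal ((norm (resolvent T (of_real r * cis t) x))\<^sup>2) \<partial>circle) =
      ennreal (2 * pi * (\<Sum>n. (r\<^sup>2) ^ n * (norm ((T ^^ n) x))\<^sup>2))"
    and "continuous_on UNIV (\<lambda>t. resolvent T (of_real r * cis t) x)"
proof -
  define c where "c = (\<lambda>n. of_real r ^ n *\<^sub>C (T ^^ n) x)"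
  have c: "summable (\<lambda>n. norm (c n))"
    unfolding c_def using summable_resolvent[of "of_real r"] r by simp
  have eq: "resolvent T (of_real r * cis t) x = (\<Sum>n. cis t ^ n *\<^sub>C c n)" for t
    by (simp add: resolvent_def c_def scaleC_scaleC power_mult_distrib mult.commute)
  have "(norm (c n))\<^sup>2 = (r\<^sup>2) ^ n * (norm ((T ^^ n) x))\<^sup>2" for n
    using r by (simp add: c_def norm_scaleC norm_power power_mult_distrib power_mult[symmetric] mult.commute)
  then show "(\<integral>\<^sup>+t. ennreal ((norm (resolvent T (of_real r * cis t) x))\<^sup>2) \<partial>circle) =
      ennreal (2 * pi * (\<Sum>n. (r\<^sup>2) ^ n * (norm ((T ^^ n) x))\<^sup>2))"
    unfolding eq using parseval[OF c] by simp
  show "continuous_on UNIV (\<lambda>t. resolvent T (of_real r * cis t) x)"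
    unfolding eq by (rule continuous_on_cis_series[OF c])
qed

end

section \<open>Abel means of null sequences\<close>

lemma summable_geometric_mult:
  fixes w :: "nat \<Rightarrow> real"
  assumes "w \<longlonglongrightarrow> 0" "0 \<le> q" "q < 1"
  shows "summable (\<lambda>n. q ^ n * w n)"
proof -
  obtain K where K: "\<And>n. norm (w n) \<le> K"
    using convergent_imp_Bseq[OF convergentI[OF assms(1)]] by (auto simp: Bseq_def)
  show ?thesis
  proof (rule summable_comparison_test')
    show "summable (\<lambda>n. q ^ n * K)"
      using assms by (intro summable_mult2 summable_geometric) auto
    show "norm (q ^ n * w n) \<le> q ^ n * K" for n
      using assms(2) K[of n] by (simp add: abs_mult mult_left_mono)
  qed
qed

text \<open>The weights \<open>(1 - s j) * s j ^ n\<close> sum to 1, so the terms from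
  \<open>N\<close> on contribute at most \<open>e / 2\<close>, while the first \<open>N\<close>
  terms carry the vanishing factor \<open>1 - s j\<close>.\<close>

lemma abel_null_sequence:
  fixes w :: "nat \<Rightarrow> real"
  assumes w: "w \<longlonglongrightarrow> 0" and nonneg: "\<And>n. 0 \<le> w n" and s: "\<And>j. 0 \<le> s j" "\<And>j. s j < 1" "s \<longlonglongrightarrow> 1"
  shows "(\<lambda>j. (1 - s j) * (\<Sum>n. s j ^ n * w n)) \<longlonglongrightarrow> 0"
proof -
  note summ = summable_geometric_mult[OF w s(1,2)]
  have nn: "0 \<le> (1 - s j) * (\<Sum>n. s j ^ n * w n)" for j
    using s(1,2)[of j] nonneg by (intro mult_nonneg_nonneg suminf_nonneg summ) (auto simp: less_imp_le)
  show "(\<lambda>j. (1 - s j) * (\<Sum>n. s j ^ n * w n)) \<longlonglongrightarrow> 0"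
  proof (rule LIMSEQ_I)
    fix e :: real assume e: "0 < e"
    have "\<forall>\<^sub>F n in sequentially. w n < e / 2"
      using order_tendstoD(2)[OF w, of "e / 2"] e by simp
    then obtain N where N: "\<And>n. n \<ge> N \<Longrightarrow> w n < e / 2"
      by (auto simp: eventually_sequentially)
    define C where "C = (\<Sum>n<N. w n)"
    have le: "(1 - s j) * (\<Sum>n. s j ^ n * w n) \<le> (1 - s j) * C + e / 2" for j
    proof -
      have "s j ^ n * w n \<le> (if n < N then w n else 0) + e / 2 * s j ^ n" for n
      proof (cases "n < N")
        case True
        have "s j ^ n * w n \<le> 1 * w n"
          using s(1,2)[of j] nonneg by (intro mult_right_mono power_le_one) (auto simp: less_imp_le)
        moreover have "0 \<le> e / 2 * s j ^ n" using e s(1) by simp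
        ultimately show ?thesis using True by simp
      next
        case False
        then have "w n * s j ^ n \<le> e / 2 * s j ^ n"
          using N[of n] s(1) by (intro mult_right_mono) auto
        then show ?thesis using False by (simp add: mult.commute)
      qed
      moreover have "(\<lambda>n. (if n < N then w n else 0) + e / 2 * s j ^ n) sums (C + e / 2 * (1 / (1 - s j)))"
        unfolding C_def using s sums_If_finite_set[of "{..<N}" w]
        by (intro sums_add sums_mult geometric_sums) auto
      ultimately have "(\<Sum>n. s j ^ n * w n) \<le> C + e / 2 * (1 / (1 - s j))"
        using summ by (intro sums_le[OF _ summable_sums]) auto
      then have "(1 - s j) * (\<Sum>n. s j ^ n * w n) \<le> (1 - s j) * (C + e / 2 * (1 / (1 - s j)))"
        using s(2)[of j] by (intro mult_left_mono) auto
      also have "\<dots> = (1 - s j) * C + e / 2"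
        using s(2)[of j] by (simp add: field_simps)
      finally show ?thesis .
    qed
    have "(\<lambda>j. (1 - s j) * C) \<longlonglongrightarrow> (1 - 1) * C"
      by (intro tendsto_intros s(3))
    from order_tendstoD(2)[OF this, of "e / 2"] have "\<forall>\<^sub>F j in sequentially. (1 - s j) * C < e / 2"
      using e by simp
    then obtain M where M: "\<And>j. j \<ge> M \<Longrightarrow> (1 - s j) * C < e / 2"
      by (auto simp: eventually_sequentially)
    have "norm ((1 - s j) * (\<Sum>n. s j ^ n * w n) - 0) < e" if "j \<ge> M" for j
      using le[of j] M[OF that] nn[of j] by simp
    then show "\<exists>M. \<forall>j\<ge>M. norm ((1 - s j) * (\<Sum>n. s j ^ n * w n) - 0) < e" by blast
  qed
qed

section \<open>State equations and energy balance of the colligation\<close>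

locale isometric_colligation =
  fixes a :: complex
    and B1 :: "'h1::complex_hilbert \<Rightarrow> complex" and B2 :: "'h2::complex_hilbert \<Rightarrow> complex"
    and C1 :: "complex \<Rightarrow> 'h1" and C2 :: "complex \<Rightarrow> 'h2"
    and D1 :: "'h1 \<Rightarrow> 'h1" and D2 :: "'h2 \<Rightarrow> 'h1" and D3 :: "'h2 \<Rightarrow> 'h2"
  assumes B1: "bounded_clinear B1" and B2: "bounded_clinear B2"
    and C1: "bounded_clinear C1" and C2: "bounded_clinear C2"
    and D1: "bounded_clinear D1" and D2: "bounded_clinear D2" and D3: "bounded_clinear D3"
    and iso: "isometric (colligation a B1 B2 C1 D1 D2 C2 (\<lambda>_. 0) D3)"
begin

text \<open>The isometry enters all later arguments through this identity; vectors with some zero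
  entries give the bounds on single blocks.\<close>

lemma norm_identity:
  "(cmod (a * w + B1 x + B2 y))\<^sup>2 + (norm (C1 w + D1 x + D2 y))\<^sup>2 + (norm (C2 w + D3 y))\<^sup>2 =
   (cmod w)\<^sup>2 + (norm x)\<^sup>2 + (norm y)\<^sup>2"
  using arg_cong[OF isometric_norm[OF iso, of "(w, x, y)"], of "\<lambda>x. x\<^sup>2"]
  by (simp add: colligation_def norm_Pair_square)

lemma norm_D1: "norm (D1 x) \<le> norm x"
proof (rule power2_le_imp_le)
  have "(cmod (B1 x))\<^sup>2 + (norm (D1 x))\<^sup>2 = (norm x)\<^sup>2"
    using norm_identity[of 0 x 0]
    by (simp add: bounded_clinearD(5)[OF C1] bounded_clinearD(5)[OF C2] bounded_clinearD(5)[OF D2]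
      bounded_clinearD(5)[OF D3] bounded_clinearD(5)[OF B2])
  then show "(norm (D1 x))\<^sup>2 \<le> (norm x)\<^sup>2"
    using zero_le_power2[of "cmod (B1 x)"] by linarith
qed simp

text \<open>The two squares are kept together: this is what telescopes along the orbit of
  \<open>D3\<close>.\<close>

lemma norm_D2_D3: "(norm (D2 y))\<^sup>2 + (norm (D3 y))\<^sup>2 \<le> (norm y)\<^sup>2"
proof -
  have "(cmod (B2 y))\<^sup>2 + (norm (D2 y))\<^sup>2 + (norm (D3 y))\<^sup>2 = (norm y)\<^sup>2"
    using norm_identity[of 0 0 y]
    by (simp add: bounded_clinearD(5)[OF C1] bounded_clinearD(5)[OF C2] bounded_clinearD(5)[OF D1]
      bounded_clinearD(5)[OF B1])
  then show ?thesis
    using zero_le_power2[of "cmod (B2 y)"] by linarith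
qed

lemma norm_D2: "norm (D2 y) \<le> norm y"
proof (rule power2_le_imp_le)
  show "(norm (D2 y))\<^sup>2 \<le> (norm y)\<^sup>2"
    using norm_D2_D3[of y] zero_le_power2[of "norm (D3 y)"] by linarith
qed simp

lemma norm_D3: "norm (D3 y) \<le> norm y"
proof (rule power2_le_imp_le)
  show "(norm (D3 y))\<^sup>2 \<le> (norm y)\<^sup>2"
    using norm_D2_D3[of y] zero_le_power2[of "norm (D2 y)"] by linarith
qed simp

sublocale D1: contraction D1 by standard (fact D1 norm_D1)+
sublocale D3: contraction D3 by standard (fact D3 norm_D3)+

text \<open>\<open>state2\<close> and \<open>state1\<close> are the components \<open>h_2\<close>
  and \<open>h_1\<close> of the overview. The zero block decouples the second equation, so
  \<open>state2\<close> and the vector \<open>input1\<close> driving \<open>D1\<close> depend on the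
  second variable alone.\<close>

definition state2 :: "complex \<Rightarrow> 'h2" where
  "state2 z = resolvent D3 z (C2 1)"

definition input1 :: "complex \<Rightarrow> 'h1" where
  "input1 z = C1 1 + D2 (z *\<^sub>C state2 z)"

definition state1 :: "complex \<times> complex \<Rightarrow> 'h1" where
  "state1 z = resolvent D1 (fst z) (input1 (snd z))"

text \<open>With \<open>h\<close> the pair of states, \<open>E(z) h\<close> is the vector that
  \<open>inv\<close> has to return, because \<open>(I - E D) E = E (I - D E)\<close>. Injectivity
  identifies it with the value of \<open>inv\<close>.\<close>

lemma transfer_function_eq:
  assumes "z \<in> bidisc"
  shows "transfer_function (colligation a B1 B2 C1 D1 D2 C2 (\<lambda>_. 0) D3) z =
    a + B1 (fst z *\<^sub>C state1 z) + B2 (snd z *\<^sub>C state2 (snd z))"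
proof -
  have z: "cmod (fst z) < 1" "cmod (snd z) < 1" using assms by (auto simp: bidisc_def)
  let ?D = "\<lambda>h. snd (colligation a B1 B2 C1 D1 D2 C2 (\<lambda>_. 0) D3 (0, h))"
  let ?h = "E_op z (state1 z, state2 (snd z))"
  have D: "?D h = (D1 (fst h) + D2 (snd h), D3 (snd h))" for h
    by (cases h) (simp add: colligation_def bounded_clinearD(5)[OF C1] bounded_clinearD(5)[OF C2])
  have C: "snd (colligation a B1 B2 C1 D1 D2 C2 (\<lambda>_. 0) D3 (1, 0)) = (C1 1, C2 1)"
    by (simp add: colligation_def zero_prod_def bounded_clinearD(5)[OF D1] bounded_clinearD(5)[OF D2] bounded_clinearD(5)[OF D3])
  \<comment> \<open>The triangular form allows back substitution: the second component involves only
    \<open>D3\<close>, and once it is fixed the first involves only \<open>D1\<close>.\<close>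
  have "inj (\<lambda>h. h - E_op z (?D h))"
  proof (rule injI)
    fix h h' assume "h - E_op z (?D h) = h' - E_op z (?D h')"
    then have 1: "fst h - fst z *\<^sub>C (D1 (fst h) + D2 (snd h)) = fst h' - fst z *\<^sub>C (D1 (fst h') + D2 (snd h'))"
      and 2: "snd h - snd z *\<^sub>C D3 (snd h) = snd h' - snd z *\<^sub>C D3 (snd h')"
      by (auto simp: E_op_def D prod_eq_iff)
    have "snd h - snd h' = snd z *\<^sub>C D3 (snd h - snd h')"
      using 2 by (simp add: bounded_clinearD(4)[OF D3] scaleC_diff_right algebra_simps)
    from D3.fixed_point_zero[OF z(2) this] have e: "snd h = snd h'" by simp
    have "fst h - fst h' = fst z *\<^sub>C D1 (fst h - fst h')"
      using 1 e by (simp add: bounded_clinearD(4)[OF D1] scaleC_diff_right scaleC_add_right algebra_simps)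
    from D1.fixed_point_zero[OF z(1) this] e show "h = h'" by (simp add: prod_eq_iff)
  qed
  moreover have "?h - E_op z (?D ?h) = E_op z (C1 1, C2 1)"
  proof -
    have "state2 (snd z) - D3 (snd z *\<^sub>C state2 (snd z)) = C2 1"
      using D3.resolvent_eq[OF z(2), of "C2 1"] by (simp add: state2_def algebra_simps)
    moreover have "state1 z - (D1 (fst z *\<^sub>C state1 z) + D2 (snd z *\<^sub>C state2 (snd z))) = C1 1"
      using D1.resolvent_eq[OF z(1), of "input1 (snd z)"] by (simp add: state1_def input1_def algebra_simps)
    ultimately show ?thesis
      by (simp add: D E_op_def scaleC_diff_right[symmetric])
  qed
  ultimately have "inv (\<lambda>h. h - E_op z (?D h)) (E_op z (C1 1, C2 1)) = ?h"
    by (metis (no_types, lifting) inv_f_f)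
  then show ?thesis
    unfolding transfer_function_def Let_def C
    by (simp add: colligation_def E_op_def zero_prod_def bounded_clinearD(5)[OF B1] bounded_clinearD(5)[OF B2])
qed

lemma one_minus_transfer_function:
  assumes "z \<in> bidisc"
  shows "1 - (cmod (transfer_function (colligation a B1 B2 C1 D1 D2 C2 (\<lambda>_. 0) D3) z))\<^sup>2 =
    (1 - (cmod (fst z))\<^sup>2) * (norm (state1 z))\<^sup>2 + (1 - (cmod (snd z))\<^sup>2) * (norm (state2 (snd z)))\<^sup>2"
proof -
  have z: "cmod (fst z) < 1" "cmod (snd z) < 1" using assms by (auto simp: bidisc_def)
  have "C2 1 + D3 (snd z *\<^sub>C state2 (snd z)) = state2 (snd z)"
    using D3.resolvent_eq[OF z(2), of "C2 1"] by (simp add: state2_def)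
  moreover have "C1 1 + D1 (fst z *\<^sub>C state1 z) + D2 (snd z *\<^sub>C state2 (snd z)) = state1 z"
    using D1.resolvent_eq[OF z(1), of "input1 (snd z)"] by (simp add: state1_def input1_def algebra_simps)
  ultimately show ?thesis
    using norm_identity[of 1 "fst z *\<^sub>C state1 z" "snd z *\<^sub>C state2 (snd z)"]
    by (simp add: transfer_function_eq[OF assms] norm_scaleC power_mult_distrib algebra_simps)
qed

text \<open>The Taylor coefficients of \<open>input1\<close>; the index is shifted by one through
  the factor \<open>z\<close> in front of \<open>state2 z\<close>.\<close>

definition input1_coeff :: "nat \<Rightarrow> 'h1" where
  "input1_coeff k = (case k of 0 \<Rightarrow> C1 1 | Suc k \<Rightarrow> D2 ((D3 ^^ k) (C2 1)))"

lemma norm_input1_coeff: "norm (input1_coeff k) \<le> norm (C1 1) + norm (C2 1)"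
  using order_trans[OF norm_D2 D3.funpow_contr] by (auto simp: input1_coeff_def add_increasing split: nat.split)

lemma summable_input1_coeff:
  assumes "cmod z < 1"
  shows "summable (\<lambda>k. norm (z ^ k *\<^sub>C input1_coeff k))"
proof (rule summable_comparison_test')
  show "summable (\<lambda>n. cmod z ^ n * (norm (C1 1) + norm (C2 1)))"
    using assms by (intro summable_mult2 summable_geometric) auto
  show "norm (norm (z ^ n *\<^sub>C input1_coeff n)) \<le> cmod z ^ n * (norm (C1 1) + norm (C2 1))" for n
    by (simp add: norm_scaleC norm_power mult_left_mono norm_input1_coeff)
qed

lemma input1_eq:
  assumes "cmod z < 1"
  shows "input1 z = (\<Sum>k. z ^ k *\<^sub>C input1_coeff k)"
proof -
  have s: "summable (\<lambda>n. z ^ n *\<^sub>C (D3 ^^ n) (C2 1))"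
    by (rule summable_norm_cancel[OF D3.summable_resolvent[OF assms]])
  have L: "bounded_linear (\<lambda>x. D2 (z *\<^sub>C x))"
    by (rule bounded_linear_compose[OF bounded_clinearD(1)[OF D2] bounded_linear_scaleC])
  have "(\<Sum>k. z ^ k *\<^sub>C input1_coeff k) = C1 1 + (\<Sum>k. z ^ Suc k *\<^sub>C input1_coeff (Suc k))"
    using suminf_split_head[OF summable_norm_cancel[OF summable_input1_coeff[OF assms]]]
    by (simp add: scaleC_one input1_coeff_def)
  also have "(\<Sum>k. z ^ Suc k *\<^sub>C input1_coeff (Suc k)) = (\<Sum>k. D2 (z *\<^sub>C (z ^ k *\<^sub>C (D3 ^^ k) (C2 1))))"
    by (simp add: input1_coeff_def bounded_clinearD(2)[OF D2] scaleC_scaleC)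
  also have "\<dots> = D2 (z *\<^sub>C state2 z)"
    unfolding state2_def resolvent_def by (rule bounded_linear.suminf[OF L s, symmetric])
  finally show ?thesis by (simp add: input1_def)
qed

text \<open>The column condition \<open>norm_D2_D3\<close> makes \<open>\<Sum>k. (norm (D2 (D3 ^^ k) v))\<^sup>2\<close> telescope.\<close>

lemma summable_input1_coeff_square: "summable (\<lambda>k. (norm (input1_coeff k))\<^sup>2)"
proof -
  let ?v = "\<lambda>k. (D3 ^^ k) (C2 1)"
  have le: "(\<Sum>k<N. (norm (D2 (?v k)))\<^sup>2) \<le> (norm (C2 1))\<^sup>2 - (norm (?v N))\<^sup>2" for N
  proof (induction N)
    case (Suc N)
    then show ?case using norm_D2_D3[of "?v N"] by simp
  qed simp
  have "(\<Sum>k<N. (norm (D2 (?v k)))\<^sup>2) \<le> (norm (C2 1))\<^sup>2" for N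
    using le[of N] zero_le_power2[of "norm (?v N)"] by linarith
  then have "summable (\<lambda>k. (norm (D2 (?v k)))\<^sup>2)"
    by (intro summableI_nonneg_bounded) auto
  then show ?thesis
    by (subst summable_Suc_iff[symmetric]) (simp add: input1_coeff_def)
qed

text \<open>The squared Hardy space norm of \<open>\<lambda>z. (D1 ^^ n) (input1 z)\<close>. After
  averaging over the second variable it takes the place of the squared orbit norm under
  \<open>D1\<close>.\<close>

definition energy :: "nat \<Rightarrow> real" where
  "energy n = (\<Sum>k. (norm ((D1 ^^ n) (input1_coeff k)))\<^sup>2)"

lemma summable_energy: "summable (\<lambda>k. (norm ((D1 ^^ n) (input1_coeff k)))\<^sup>2)"
  by (rule summable_comparison_test'[OF summable_input1_coeff_square])
    (simp add: power_mono D1.funpow_contr)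

lemma energy_nonneg: "0 \<le> energy n"
  unfolding energy_def by (intro suminf_nonneg summable_energy) auto

text \<open>Each term tends to 0 and, as \<open>D1\<close> is a contraction, is dominated by the
  square-summable coefficients of \<open>input1\<close>; Tannery's theorem gives the limit of the
  sum.\<close>

lemma energy_tendsto_0:
  assumes "\<And>x. (\<lambda>n. (D1 ^^ n) x) \<longlonglongrightarrow> 0"
  shows "energy \<longlonglongrightarrow> 0"
proof -
  have "(\<lambda>n. \<Sum>k. (norm ((D1 ^^ n) (input1_coeff k)))\<^sup>2) \<longlonglongrightarrow> (\<Sum>k. 0)"
  proof (rule tannerys_theorem[THEN conjunct2, THEN conjunct2, OF _ _ summable_input1_coeff_square])
    show "(\<lambda>n. (norm ((D1 ^^ n) (input1_coeff k)))\<^sup>2) \<longlonglongrightarrow> 0" for k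
      using tendsto_power[OF tendsto_norm[OF assms[of "input1_coeff k"]], of 2] by simp
    show "\<forall>\<^sub>F (k, n) in sequentially \<times>\<^sub>F sequentially.
        norm ((norm ((D1 ^^ n) (input1_coeff k)))\<^sup>2) \<le> (norm (input1_coeff k))\<^sup>2"
      by (intro always_eventually) (auto intro: power_mono D1.funpow_contr)
  qed simp
  then show ?thesis by (simp add: energy_def[abs_def])
qed

text \<open>Parseval produces extra factors \<open>r ^ k\<close> in the coefficients; dropping them
  gives a bound uniform in \<open>r\<close>.\<close>

lemma mean_square_D1_input1:
  assumes r: "0 \<le> r" "r < 1"
  shows "(\<integral>\<^sup>+t. ennreal ((norm ((D1 ^^ n) (input1 (of_real r * cis t))))\<^sup>2) \<partial>circle) \<le> ennreal (2 * pi * energy n)"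
    and "continuous_on UNIV (\<lambda>t. (D1 ^^ n) (input1 (of_real r * cis t)))"
proof -
  note L = D1.funpow_clinear[of n]
  define c where "c = (\<lambda>k. (D1 ^^ n) (of_real r ^ k *\<^sub>C input1_coeff k))"
  have c: "summable (\<lambda>k. norm (c k))"
    by (rule summable_comparison_test'[OF summable_input1_coeff[of "of_real r"]])
      (use r in \<open>simp_all add: c_def D1.funpow_contr\<close>)
  have eq: "(D1 ^^ n) (input1 (of_real r * cis t)) = (\<Sum>k. cis t ^ k *\<^sub>C c k)" for t
  proof -
    have "summable (\<lambda>k. (of_real r * cis t) ^ k *\<^sub>C input1_coeff k)"
      using summable_norm_cancel[OF summable_input1_coeff] r by (simp add: norm_mult)
    from bounded_linear.suminf[OF bounded_clinearD(1)[OF L] this]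
    show ?thesis
      using r by (simp add: input1_eq norm_mult c_def bounded_clinearD(2)[OF L] scaleC_scaleC power_mult_distrib mult.commute)
  qed
  have "(norm (c k))\<^sup>2 \<le> (norm ((D1 ^^ n) (input1_coeff k)))\<^sup>2" for k
    using r by (intro power_mono)
      (auto simp: c_def bounded_clinearD(2)[OF L] norm_scaleC norm_power power_le_one mult_left_le_one_le)
  then have "(\<Sum>k. (norm (c k))\<^sup>2) \<le> energy n"
    unfolding energy_def by (intro suminf_le summable_norm_square c summable_energy)
  then show "(\<integral>\<^sup>+t. ennreal ((norm ((D1 ^^ n) (input1 (of_real r * cis t))))\<^sup>2) \<partial>circle) \<le> ennreal (2 * pi * energy n)"
    unfolding eq parseval[OF c] by (intro ennreal_leI) auto
  show "continuous_on UNIV (\<lambda>t. (D1 ^^ n) (input1 (of_real r * cis t)))"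
    unfolding eq by (rule continuous_on_cis_series[OF c])
qed

lemma borel_measurable_D1_input1:
  assumes r: "0 \<le> r" "r < 1"
  shows "(\<lambda>t. (norm ((D1 ^^ n) (input1 (of_real r * cis t))))\<^sup>2) \<in> borel_measurable circle"
  by (intro borel_measurable_circle borel_measurable_continuous_onI continuous_intros mean_square_D1_input1 r)

text \<open>Parseval in the first variable. The series is written in \<open>ennreal\<close>, ready
  to be integrated termwise in the second one; it also shows measurability in
  \<open>t'\<close>.\<close>

lemma mean_square_state1_slice:
  assumes r: "0 \<le> r" "r < 1"
  shows "(\<integral>\<^sup>+t. ennreal ((norm (state1 (of_real r * cis t, of_real r * cis t')))\<^sup>2) \<partial>circle) =
      (\<Sum>n. ennreal (2 * pi * (r\<^sup>2) ^ n) * ennreal ((norm ((D1 ^^ n) (input1 (of_real r * cis t'))))\<^sup>2))"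
proof -
  let ?v = "\<lambda>n t'. (D1 ^^ n) (input1 (of_real r * cis t'))"
  have "summable (\<lambda>n. (r\<^sup>2) ^ n * (norm (?v n t'))\<^sup>2)"
    using summable_norm_square[OF D1.summable_resolvent[of "of_real r" "input1 (of_real r * cis t')"]] r
    by (simp add: norm_scaleC norm_power power_mult_distrib power_mult[symmetric] mult.commute)
  then have "summable (\<lambda>n. 2 * pi * ((r\<^sup>2) ^ n * (norm (?v n t'))\<^sup>2))"
    and "2 * pi * (\<Sum>n. (r\<^sup>2) ^ n * (norm (?v n t'))\<^sup>2) = (\<Sum>n. 2 * pi * ((r\<^sup>2) ^ n * (norm (?v n t'))\<^sup>2))"
    by (auto intro: summable_mult suminf_mult[symmetric])
  then show ?thesis
    by (simp add: state1_def D1.mean_square_resolvent[OF r] suminf_ennreal2[symmetric] ennreal_mult mult.assoc)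
qed

lemma mean_square_state1:
  assumes r: "0 \<le> r" "r < 1" and s: "summable (\<lambda>n. (r\<^sup>2) ^ n * energy n)"
  shows "(\<integral>\<^sup>+t'. \<integral>\<^sup>+t. ennreal ((norm (state1 (of_real r * cis t, of_real r * cis t')))\<^sup>2) \<partial>circle \<partial>circle) \<le>
     ennreal (4 * pi\<^sup>2 * (\<Sum>n. (r\<^sup>2) ^ n * energy n))"
proof -
  let ?v = "\<lambda>n t'. (D1 ^^ n) (input1 (of_real r * cis t'))"
  note borel_measurable_D1_input1[OF r, measurable]
  have "(\<integral>\<^sup>+t'. \<integral>\<^sup>+t. ennreal ((norm (state1 (of_real r * cis t, of_real r * cis t')))\<^sup>2) \<partial>circle \<partial>circle) =
     (\<integral>\<^sup>+t'. (\<Sum>n. ennreal (2 * pi * (r\<^sup>2) ^ n) * ennreal ((norm (?v n t'))\<^sup>2)) \<partial>circle)"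
    by (simp only: mean_square_state1_slice[OF r])
  also have "\<dots> = (\<Sum>n. ennreal (2 * pi * (r\<^sup>2) ^ n) * (\<integral>\<^sup>+t'. ennreal ((norm (?v n t'))\<^sup>2) \<partial>circle))"
    by (simp add: nn_integral_suminf nn_integral_cmult)
  also have "\<dots> \<le> (\<Sum>n. ennreal (2 * pi * (r\<^sup>2) ^ n) * ennreal (2 * pi * energy n))"
    by (intro suminf_le mult_left_mono mean_square_D1_input1 r) auto
  also have "\<dots> = (\<Sum>n. ennreal (4 * pi\<^sup>2 * ((r\<^sup>2) ^ n * energy n)))"
    using energy_nonneg by (simp add: ennreal_mult[symmetric] power2_eq_square mult_ac)
  also have "\<dots> = ennreal (4 * pi\<^sup>2 * (\<Sum>n. (r\<^sup>2) ^ n * energy n))"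
    using s energy_nonneg by (subst suminf_ennreal2) (auto intro: summable_mult simp: suminf_mult)
  finally show ?thesis .
qed

text \<open>With \<open>r = sqrt s\<close> the weights \<open>1 - r\<^sup>2\<close> and
  \<open>(r\<^sup>2) ^ n\<close> become \<open>1 - s\<close> and \<open>s ^ n\<close>, so both parts
  of the defect are bounded by Abel means. Strong stability of \<open>D1\<close> and
  \<open>D3\<close> makes \<open>energy\<close> and \<open>v\<close> null sequences.\<close>

lemma defect_tendsto_0:
  assumes "C0_dot D1" "C0_dot D3" and s: "\<And>j. 0 \<le> s j" "\<And>j. s j < 1" "s \<longlonglongrightarrow> 1"
  defines "r \<equiv> \<lambda>j. sqrt (s j)"
  shows "(\<lambda>j. \<integral>\<^sup>+t'. \<integral>\<^sup>+t. ennreal (1 - (cmod (transfer_function (colligation a B1 B2 C1 D1 D2 C2 (\<lambda>_. 0) D3)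
      (of_real (r j) * cis t, of_real (r j) * cis t')))\<^sup>2) \<partial>circle \<partial>circle) \<longlonglongrightarrow> 0"
proof -
  have r: "0 \<le> r j" "r j < 1" "(r j)\<^sup>2 = s j" for j
    using s(1,2)[of j] by (auto simp: r_def)
  have w0: "energy \<longlonglongrightarrow> 0" using assms(1) by (intro energy_tendsto_0) (auto simp: C0_dot_def)
  define v where "v = (\<lambda>n. (norm ((D3 ^^ n) (C2 1)))\<^sup>2)"
  have v0: "v \<longlonglongrightarrow> 0" unfolding v_def
    using assms(2) tendsto_power[OF tendsto_norm, of "\<lambda>n. (D3 ^^ n) (C2 1)" 0 sequentially 2]
    by (auto simp: C0_dot_def)
  note abel_w = abel_null_sequence[OF w0 energy_nonneg s]
  note abel_v = abel_null_sequence[OF v0 _ s]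
  let ?I = "\<lambda>j. \<integral>\<^sup>+t'. \<integral>\<^sup>+t. ennreal (1 - (cmod (transfer_function (colligation a B1 B2 C1 D1 D2 C2 (\<lambda>_. 0) D3)
      (of_real (r j) * cis t, of_real (r j) * cis t')))\<^sup>2) \<partial>circle \<partial>circle"
  let ?U = "\<lambda>j. 4 * pi\<^sup>2 * ((1 - s j) * (\<Sum>n. s j ^ n * energy n)) + 4 * pi\<^sup>2 * ((1 - s j) * (\<Sum>n. s j ^ n * v n))"
  have linear: "(\<integral>\<^sup>+t. c * A t + d * B t \<partial>circle) = c * (\<integral>\<^sup>+t. A t \<partial>circle) + d * (\<integral>\<^sup>+t. B t \<partial>circle)"
    if "A \<in> borel_measurable circle" "B \<in> borel_measurable circle" for A B c d
    using that by (simp add: nn_integral_add nn_integral_cmult)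
  have "?I j \<le> ennreal (?U j)" for j
  proof -
    let ?G = "\<lambda>t'. \<integral>\<^sup>+t. ennreal ((norm (state1 (of_real (r j) * cis t, of_real (r j) * cis t')))\<^sup>2) \<partial>circle"
    let ?H = "\<lambda>t'. ennreal ((norm (state2 (of_real (r j) * cis t')))\<^sup>2)"
    note borel_measurable_D1_input1[OF r(1,2), measurable]
    have [measurable]: "?G \<in> borel_measurable circle"
      unfolding mean_square_state1_slice[OF r(1,2)] by measurable
    have "(\<lambda>t'. (norm (state2 (of_real (r j) * cis t')))\<^sup>2) \<in> borel_measurable circle"
      unfolding state2_def
      by (intro borel_measurable_circle borel_measurable_continuous_onI continuous_intros D3.mean_square_resolvent r)
    then have [measurable]: "?H \<in> borel_measurable circle"
      by measurable
    have "?I j = (\<integral>\<^sup>+t'. \<integral>\<^sup>+t. ennreal (1 - s j) * ennreal ((norm (state1 (of_real (r j) * cis t, of_real (r j) * cis t')))\<^sup>2) +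
        ennreal (1 - s j) * ennreal ((norm (state2 (of_real (r j) * cis t')))\<^sup>2) \<partial>circle \<partial>circle)"
    proof (intro nn_integral_cong)
      fix t t' :: real
      show "ennreal (1 - (cmod (transfer_function (colligation a B1 B2 C1 D1 D2 C2 (\<lambda>_. 0) D3)
        (of_real (r j) * cis t, of_real (r j) * cis t')))\<^sup>2) =
        ennreal (1 - s j) * ennreal ((norm (state1 (of_real (r j) * cis t, of_real (r j) * cis t')))\<^sup>2) +
        ennreal (1 - s j) * ennreal ((norm (state2 (of_real (r j) * cis t')))\<^sup>2)"
        unfolding one_minus_transfer_function[OF in_bidisc_radial[OF r(1,2)]]
        using r[of j] s(2)[of j] by (simp add: norm_mult ennreal_mult)
    qed
    \<comment> \<open>\<open>?H t'\<close> is constant in \<open>t\<close>, so the inner integration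
      multiplies it by the mass \<open>2 * pi\<close>.\<close>
    also have "\<dots> = (\<integral>\<^sup>+t'. (ennreal (1 - s j) * ?G t' + ennreal (2 * pi * (1 - s j)) * ?H t') \<partial>circle)"
    proof (rule nn_integral_cong)
      fix t'
      have scale: "ennreal (2 * pi * (1 - s j)) = ennreal (2 * pi) * ennreal (1 - s j)"
        using s(2)[of j] by (intro ennreal_mult) auto
      have "(\<lambda>t. (norm (state1 (of_real (r j) * cis t, of_real (r j) * cis t')))\<^sup>2) \<in> borel_measurable circle"
        unfolding state1_def fst_conv snd_conv
        by (intro borel_measurable_circle borel_measurable_continuous_onI continuous_intros D1.mean_square_resolvent r)
      then have "(\<lambda>t. ennreal ((norm (state1 (of_real (r j) * cis t, of_real (r j) * cis t')))\<^sup>2)) \<in> borel_measurable circle"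
        by measurable
      from linear[OF this, of "\<lambda>_. ?H t'" "ennreal (1 - s j)" "ennreal (1 - s j)"]
      show "(\<integral>\<^sup>+t. ennreal (1 - s j) * ennreal ((norm (state1 (of_real (r j) * cis t, of_real (r j) * cis t')))\<^sup>2) +
        ennreal (1 - s j) * ?H t' \<partial>circle) =
        ennreal (1 - s j) * ?G t' + ennreal (2 * pi * (1 - s j)) * ?H t'"
        unfolding scale by (simp add: emeasure_circle mult_ac)
    qed
    also have "\<dots> = ennreal (1 - s j) * (\<integral>\<^sup>+t'. ?G t' \<partial>circle) + ennreal (2 * pi * (1 - s j)) * (\<integral>\<^sup>+t'. ?H t' \<partial>circle)"
      by (rule linear) fact+
    also have "\<dots> \<le> ennreal (1 - s j) * ennreal (4 * pi\<^sup>2 * (\<Sum>n. s j ^ n * energy n)) +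
        ennreal (2 * pi * (1 - s j)) * ennreal (2 * pi * (\<Sum>n. s j ^ n * v n))"
    proof (intro add_mono mult_left_mono)
      show "(\<integral>\<^sup>+t'. ?G t' \<partial>circle) \<le> ennreal (4 * pi\<^sup>2 * (\<Sum>n. s j ^ n * energy n))"
        using mean_square_state1[OF r(1,2)[of j]] summable_geometric_mult[OF w0 s(1,2)] by (simp only: r(3))
      show "(\<integral>\<^sup>+t'. ?H t' \<partial>circle) \<le> ennreal (2 * pi * (\<Sum>n. s j ^ n * v n))"
        using D3.mean_square_resolvent(1)[OF r(1,2)[of j], of "C2 1"] by (simp only: r(3) v_def state2_def)
    qed auto
    also have "\<dots> = ennreal (?U j)"
    proof -
      have "0 \<le> (\<Sum>n. s j ^ n * energy n)" "0 \<le> (\<Sum>n. s j ^ n * v n)"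
        using s(1) energy_nonneg summable_geometric_mult[OF w0 s(1,2)] summable_geometric_mult[OF v0 s(1,2)]
        by (auto intro!: suminf_nonneg simp: v_def)
      then show ?thesis
        using s(2)[of j] by (simp add: ennreal_mult[symmetric] ennreal_plus[symmetric] power2_eq_square mult_ac del: ennreal_plus)
    qed
    finally show ?thesis .
  qed
  moreover have "(\<lambda>j. ennreal (?U j)) \<longlonglongrightarrow> ennreal (4 * pi\<^sup>2 * 0 + 4 * pi\<^sup>2 * 0)"
    by (intro tendsto_ennrealI tendsto_intros abel_w abel_v) (simp add: v_def)
  ultimately show ?thesis
    by (intro tendsto_sandwich[of "\<lambda>_. 0" ?I sequentially "\<lambda>j. ennreal (?U j)"]) auto
qed

end

text \<open>A vanishing lower limit yields one radius \<open>r j\<close> arbitrarily near 1 at which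
  the modulus is almost 1; the Cauchy condition carries this to all radii near 1.\<close>

lemma radially_cauchy_norm_tendsto_1:
  fixes g :: "real \<Rightarrow> complex"
  assumes cauchy: "radially_cauchy g" and bound: "\<And>r. 0 \<le> r \<Longrightarrow> r < 1 \<Longrightarrow> cmod (g r) \<le> 1"
    and r: "\<And>j. 0 \<le> r j" "\<And>j. r j < 1" "r \<longlonglongrightarrow> 1"
    and lim: "liminf (\<lambda>j. ennreal (1 - (cmod (g (r j)))\<^sup>2)) = 0"
  shows "((\<lambda>r. cmod (g r)) \<longlongrightarrow> 1) (at_left 1)"
proof (rule tendstoI)
  fix e :: real assume e: "0 < e"
  obtain k where k: "1 / real (Suc k) < e / 2" using nat_approx_posE[of "e / 2"] e by auto
  obtain m where m: "\<And>q q'. q \<in> {1 - 1 / Suc m<..<1} \<Longrightarrow> q' \<in> {1 - 1 / Suc m<..<1} \<Longrightarrow> dist (g q) (g q') \<le> 1 / Suc k"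
    using cauchy unfolding radially_cauchy_def by blast
  have "1 - 1 / real (Suc m) < 1" by simp
  from order_tendstoD(1)[OF r(3) this] have ev: "\<forall>\<^sub>F j in sequentially. 1 - 1 / real (Suc m) < r j" .
  have "\<not> (\<forall>\<^sub>F j in sequentially. ennreal (e / 2) \<le> ennreal (1 - (cmod (g (r j)))\<^sup>2))"
  proof
    assume "\<forall>\<^sub>F j in sequentially. ennreal (e / 2) \<le> ennreal (1 - (cmod (g (r j)))\<^sup>2)"
    then have "ennreal (e / 2) \<le> liminf (\<lambda>j. ennreal (1 - (cmod (g (r j)))\<^sup>2))"
      by (rule Liminf_bounded)
    then show False using lim e by simp
  qed
  then have "\<exists>\<^sub>F j in sequentially. ennreal (1 - (cmod (g (r j)))\<^sup>2) < ennreal (e / 2)"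
    by (simp add: frequently_def not_less)
  from frequently_ex[OF frequently_eventually_conj[OF this ev]]
  obtain j where j: "ennreal (1 - (cmod (g (r j)))\<^sup>2) < ennreal (e / 2)" "1 - 1 / real (Suc m) < r j"
    by auto
  \<comment> \<open>Since the modulus is at most 1, its defect is bounded by that of its
    square.\<close>
  have "(cmod (g (r j)))\<^sup>2 \<le> cmod (g (r j))"
    using bound[OF r(1,2)[of j]] by (simp add: power2_eq_square mult_left_le)
  moreover have "1 - (cmod (g (r j)))\<^sup>2 < e / 2"
    using j(1) by (meson ennreal_leI not_less)
  ultimately have gj: "1 - e / 2 < cmod (g (r j))" by linarith
  have "dist (cmod (g q)) 1 < e" if q: "1 - 1 / Suc m < q" "q < 1" for q
  proof -
    have "1 / real (Suc m) \<le> 1" by simp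
    with q have "0 \<le> q" by linarith
    then have "cmod (g q) \<le> 1" using q by (intro bound)
    moreover have "dist (g (r j)) (g q) \<le> 1 / Suc k"
      using q j(2) r(2)[of j] by (intro m) auto
    then have "cmod (g (r j)) - cmod (g q) \<le> 1 / Suc k"
      using norm_triangle_ineq2[of "g (r j)" "g q"] by (simp add: dist_norm)
    ultimately show ?thesis using gj k by (simp add: dist_real_def)
  qed
  then show "\<forall>\<^sub>F q in at_left 1. dist (cmod (g q)) 1 < e"
    unfolding eventually_at_left_field by (intro exI[of _ "1 - 1 / Suc m"]) auto
qed

section \<open>Mean square convergence combined with radial limits\<close>

theorem theorem2p1:
  fixes \<phi> :: "complex \<times> complex \<Rightarrow> complex"
    and V :: "complex \<times> ('h1::complex_hilbert \<times> 'h2::complex_hilbert) \<Rightarrow> complex \<times> ('h1 \<times> 'h2)"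
    and a :: complex
    and B1 :: "'h1 \<Rightarrow> complex" and B2 :: "'h2 \<Rightarrow> complex"
    and C1 :: "complex \<Rightarrow> 'h1" and C2 :: "complex \<Rightarrow> 'h2"
    and D1 :: "'h1 \<Rightarrow> 'h1" and D2 :: "'h2 \<Rightarrow> 'h1" and D3 :: "'h2 \<Rightarrow> 'h2"
  assumes "\<phi> \<in> schur_class"
    and "bounded_clinear B1" and "bounded_clinear B2"
    and "bounded_clinear C1" and "bounded_clinear C2"
    and "bounded_clinear D1" and "bounded_clinear D2" and "bounded_clinear D3"
    and "V = colligation a B1 B2 C1 D1 D2 C2 (\<lambda>_. 0) D3"
    and "isometric V"
    and "C0_dot D1" and "C0_dot D3"
    and "\<forall>z\<in>bidisc. \<phi> z = transfer_function V z"
  shows "inner_function \<phi>"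
proof -
  interpret isometric_colligation a B1 B2 C1 C2 D1 D2 D3
    using assms by unfold_locales auto
  define s where "s = (\<lambda>j::nat. 1 - 1 / real (Suc j))"
  have s: "0 \<le> s j" "s j < 1" for j by (auto simp: s_def)
  have s_lim: "s \<longlonglongrightarrow> 1"
    using tendsto_diff[OF tendsto_const[of "1::real"] LIMSEQ_inverse_real_of_nat]
    by (simp add: s_def[abs_def] inverse_eq_divide)
  define r where "r = (\<lambda>j. sqrt (s j))"
  have r: "0 \<le> r j" "r j < 1" for j
    using s[of j] by (auto simp: r_def)
  have r_lim: "r \<longlonglongrightarrow> 1"
    using tendsto_real_sqrt[OF s_lim] by (simp add: r_def[abs_def])
  define f where "f = (\<lambda>j t. ennreal (1 - (cmod (\<phi> (of_real (r j) * cis (fst t), of_real (r j) * cis (snd t))))\<^sup>2))"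
  note cont = schur_class_continuous_on[OF assms(1)]
  have f_borel [measurable]: "f j \<in> borel_measurable borel" for j
    unfolding f_def
    by (intro measurable_compose[OF _ measurable_ennreal] borel_measurable_continuous_onI
        continuous_intros continuous_on_torus_radial cont r)
  note [measurable] = borel_measurable_torus[OF f_borel]
  have "(\<lambda>j. \<integral>\<^sup>+t'. \<integral>\<^sup>+t. f j (t, t') \<partial>circle \<partial>circle) \<longlonglongrightarrow> 0"
    using defect_tendsto_0[OF assms(11,12) s s_lim] assms(9,13) in_bidisc_radial[OF r]
    by (simp add: f_def r_def)
  then have int_lim: "(\<lambda>j. \<integral>\<^sup>+t. f j t \<partial>(circle \<Otimes>\<^sub>M circle)) \<longlonglongrightarrow> 0"
    by (simp add: torus.nn_integral_snd)
  \<comment> \<open>Fatou's lemma turns convergence of the means into a vanishing lower limit at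
    almost every point. This suffices because the radial limit is known to exist almost
    everywhere.\<close>
  have "(\<integral>\<^sup>+t. liminf (\<lambda>j. f j t) \<partial>(circle \<Otimes>\<^sub>M circle)) \<le> liminf (\<lambda>j. \<integral>\<^sup>+t. f j t \<partial>(circle \<Otimes>\<^sub>M circle))"
    by (rule nn_integral_liminf) measurable
  also have "\<dots> = 0"
    using int_lim by (rule lim_imp_Liminf[rotated]) simp
  finally have "(\<integral>\<^sup>+t. liminf (\<lambda>j. f j t) \<partial>(circle \<Otimes>\<^sub>M circle)) = 0"
    by simp
  then have "AE t in circle \<Otimes>\<^sub>M circle. liminf (\<lambda>j. f j t) = 0"
    by (subst (asm) nn_integral_0_iff_AE) auto
  let ?g = "\<lambda>t r. \<phi> (of_real r * cis (fst t), of_real r * cis (snd t))"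
  \<comment> \<open>Both conditions are Borel, which allows the transfer of \<open>?P\<close> to
    Lebesgue measure before the radial limit is evaluated.\<close>
  let ?P = "\<lambda>t. radially_cauchy (?g t) \<and> liminf (\<lambda>j. f j t) = 0"
  have "{t. liminf (\<lambda>j. f j t) = 0} \<in> sets borel"
    by measurable
  from sets.Int[OF sets_radially_cauchy[OF cont] this]
  have P_borel: "{t. ?P t} \<in> sets borel"
    by (simp add: Collect_conj_eq)
  have P_AE: "AE t in circle \<Otimes>\<^sub>M circle. ?P t"
    using fatou_radial_torus[OF assms(1)] \<open>AE t in circle \<Otimes>\<^sub>M circle. liminf (\<lambda>j. f j t) = 0\<close>
    by eventually_elim auto
  have "AE t in lebesgue_on ({0..2 * pi} \<times> {0..2 * pi}). ((\<lambda>r. cmod (?g t r)) \<longlongrightarrow> 1) (at_left 1)"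
    using AE_torus_lebesgue[OF P_borel P_AE]
  proof eventually_elim
    case (elim t)
    then show ?case
      using schur_class_norm_le_1[OF assms(1) in_bidisc_radial]
      by (intro radially_cauchy_norm_tendsto_1[of "?g t" r]) (auto simp: r r_lim f_def)
  qed
  then show ?thesis
    using assms(1) by (simp add: inner_function_def)
qed

end
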